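(* Suppose that $(N_t)_{0\le t\le 1}$ is a p.i.-counting process with first jump time $T_1$. Define $\tilde N(u)=N(e^u)$ for $u\in(-\infty,0]$ and $t_1=\log T_1$. Then $$M(e^u)=N(e^u\vee T_1)-N(T_1)-\int_{T_1}^{e^u\vee T_1}\frac{N_s}{s}\,ds=\tilde N(u\vee t_1)-\tilde N(t_1)-\int_{t_1}^{u\vee t_1}\tilde N(s)\,ds,\qquad u\in(-\infty,0],$$ is a martingale in its own filtration, and $\tilde N$ is a pure birth process started with one individual at time $t_1$; that is, conditionally on $t_1$, the process $(\tilde N(t_1+s))_{0\le s\le -t_1}$ has the law, restricted to the time interval $[0,-t_1]$, of the continuous-time Markov chain on $\{1,2,3,\dots\}$ started at $1$ that jumps from $n$ to $n+1$ at rate $n$.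
   Context: A counting process $(N_t)_{0\le t\le 1}$ (also written $N(t)$) has $N_0=0$ and is right-continuous, integer-valued and finite, non-decreasing, with all jumps equal to $1$. It is assumed that $N_1\ge1$, so that the first jump time $T_1=\inf\{t:N_t=1\}$ lies in $(0,1]$. P.i.-counting process (proportional increments): a counting process $(N_t)_{0\le t\le 1}$ (with $N_0=0$, right-continuous, integer-valued and finite, non-decreasing, with all jumps equal to $1$), with $N_1\ge 1$ and first jump time $T_1=\inf\{t:N_t=1\}\in(0,1]$, such that $$M_t = N_{t\vee T_1}-N_{T_1}-\int_{T_1}^{t\vee T_1}\frac{N_s}{s}\,ds,\qquad t\in(0,1],$$ is a martingale in its own filtration, meaning the natural filtration of the counting process $N$. The law of $T_1$ is otherwise unrestricted. "Its own filtration" for $(M(e^u))_{u\le0}$ correspondingly means the natural filtration of $\tilde N$. *)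

theory Defs
  imports "HOL-Probability.Probability"
begin

section \<open>Filtrations and martingales indexed by a set of times\<close>

definition natural_filtration ::
  "'a measure \<Rightarrow> real set \<Rightarrow> (real \<Rightarrow> 'a \<Rightarrow> nat) \<Rightarrow> real \<Rightarrow> 'a measure" where
  "natural_filtration M I X t =
     sigma (space M) {X s -` A \<inter> space M | s A. s \<in> I \<and> s \<le> t}"

definition martingale_on ::
  "'a measure \<Rightarrow> real set \<Rightarrow> (real \<Rightarrow> 'a measure) \<Rightarrow> (real \<Rightarrow> 'a \<Rightarrow> real) \<Rightarrow> bool" where
  "martingale_on M I F X \<longleftrightarrow>
     filtration (space M) F \<and>
     (\<forall>t\<in>I. subalgebra M (F t)) \<and>
     (\<forall>t\<in>I. X t \<in> borel_measurable (F t)) \<and>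
     (\<forall>t\<in>I. integrable M (X t)) \<and>
     (\<forall>s\<in>I. \<forall>t\<in>I. s \<le> t \<longrightarrow> (AE \<omega> in M. real_cond_exp M (F s) (X t) \<omega> = X s \<omega>))"

section \<open>P.i.-counting processes\<close>

text \<open>Only the values at times in \<open>[0, 1]\<close> matter. Since a counting process starts at \<open>0\<close> and is
  non-decreasing, its integer values are taken in \<^typ>\<open>nat\<close>.\<close>

definition counting_process :: "'a measure \<Rightarrow> (real \<Rightarrow> 'a \<Rightarrow> nat) \<Rightarrow> bool" where
  "counting_process M N \<longleftrightarrow>
     (\<forall>t\<in>{0..1}. N t \<in> measurable M (count_space UNIV)) \<and>
     (\<forall>\<omega>\<in>space M.
        N 0 \<omega> = 0 \<and>
        mono_on {0..1} (\<lambda>t. N t \<omega>) \<and>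
        (\<forall>t\<in>{0..<1}. continuous (at_right t) (\<lambda>s. N s \<omega>)) \<and>
        (\<forall>t\<in>{0<..1}. \<exists>l. ((\<lambda>s. N s \<omega>) \<longlongrightarrow> l) (at_left t) \<and> N t \<omega> \<in> {l, l + 1}))"

definition first_jump :: "(real \<Rightarrow> 'a \<Rightarrow> nat) \<Rightarrow> 'a \<Rightarrow> real" where
  "first_jump N \<omega> = Inf {t \<in> {0..1}. N t \<omega> = 1}"

definition pi_compensated :: "(real \<Rightarrow> 'a \<Rightarrow> nat) \<Rightarrow> real \<Rightarrow> 'a \<Rightarrow> real" where
  "pi_compensated N t \<omega> =
     (let T1 = first_jump N \<omega> in
        real (N (max t T1) \<omega>) - real (N T1 \<omega>) - (LBINT s:{T1..max t T1}. real (N s \<omega>) / s))"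

definition pi_counting_process :: "'a measure \<Rightarrow> (real \<Rightarrow> 'a \<Rightarrow> nat) \<Rightarrow> bool" where
  "pi_counting_process M N \<longleftrightarrow>
     counting_process M N \<and>
     (\<forall>\<omega>\<in>space M. N 1 \<omega> \<ge> 1) \<and>
     martingale_on M {0<..1} (natural_filtration M {0..1} N) (pi_compensated N)"

section \<open>Pure birth chains\<close>

text \<open>The chain on \<open>{1, 2, 3, \<dots>}\<close> started at \<open>1\<close> that jumps from \<open>n\<close> to \<open>n + 1\<close> at rate
  \<open>rate n\<close>: it stays in state \<open>n\<close> for an exponential time \<open>h n\<close> of that rate, independently of the
  other holding times. Thus it is in state \<open>n\<close> at time \<open>s\<close> iff
  \<open>h 1 + \<dots> + h (n - 1) \<le> s < h 1 + \<dots> + h n\<close>. The value \<open>0\<close>, which is not a state, marks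
  times after an explosion.\<close>

definition holding_times :: "(nat \<Rightarrow> real) \<Rightarrow> (nat \<Rightarrow> real) measure" where
  "holding_times rate =
     (\<Pi>\<^sub>M n\<in>{1..}. density lborel (\<lambda>x. ennreal (exponential_density (rate n) x)))"

definition birth_path :: "(nat \<Rightarrow> real) \<Rightarrow> real \<Rightarrow> nat" where
  "birth_path h s =
     (if \<exists>n. s < (\<Sum>k=1..n. h k) then LEAST n. s < (\<Sum>k=1..n. h k) else 0)"

definition path_space :: "(real \<Rightarrow> nat) measure" where
  "path_space = (\<Pi>\<^sub>M s\<in>{0..}. count_space UNIV)"

text \<open>The restriction of a path to \<open>[0, r]\<close>, encoded as a path on \<open>[0, \<infinity>)\<close> that takes the
  value \<open>0\<close> (not a state of the chain) after \<open>r\<close>; this puts the restrictions for all \<open>r\<close> into the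
  same space.\<close>

definition restrict_path :: "real \<Rightarrow> (real \<Rightarrow> nat) \<Rightarrow> real \<Rightarrow> nat" where
  "restrict_path r x = (\<lambda>s\<in>{0..}. if s \<le> r then x s else 0)"

definition pure_birth_law :: "(nat \<Rightarrow> real) \<Rightarrow> real \<Rightarrow> (real \<Rightarrow> nat) measure" where
  "pure_birth_law rate r =
     distr (holding_times rate) path_space (\<lambda>h. restrict_path r (birth_path h))"

definition has_conditional_law ::
  "'a measure \<Rightarrow> ('a \<Rightarrow> real) \<Rightarrow> 'b measure \<Rightarrow> ('a \<Rightarrow> 'b) \<Rightarrow> (real \<Rightarrow> 'b measure) \<Rightarrow> bool" where
  "has_conditional_law M T S X K \<longleftrightarrow>
     T \<in> borel_measurable M \<and> X \<in> measurable M S \<and>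
     (\<forall>A\<in>sets S. AE \<omega> in M.
        real_cond_exp M (vimage_algebra (space M) T borel) (indicator (X -` A \<inter> space M)) \<omega>
          = measure (K (T \<omega>)) A)"

end

theory Submission
  imports Defs
begin

text \<open>In logarithmic time \<open>u = ln t\<close> the compensator \<open>\<integral> N\<^sub>s / s ds\<close> becomes \<open>\<integral> N'(s) ds\<close>, by
  substitution. Let \<open>A\<close> be an event known at time \<open>u\<close> on which the process is in state \<open>n \<ge> 1\<close>.
  Stopping the martingale at the next jump shows that \<open>p(v) = P(A, N'(v) = n)\<close> satisfies
  \<open>n (s - r) p(s) \<le> p(r) - p(s) \<le> n (s - r) p(r)\<close> for \<open>r \<le> s\<close>, hence
  \<open>p(v) = exp (- n (v - u)) P(A)\<close>. By right-continuity this passes from fixed times to the \<open>n\<close>-th jump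
  time: given the past at that time, the holding time in state \<open>n\<close> is exponential of rate \<open>n\<close>, cut off at
  time \<open>0\<close>. Completing the holding times that are cut off with independent exponential variables yields
  a sequence with the law of the holding times of the pure birth chain, independent of the first jump time,
  and the path up to time \<open>0\<close> is the path of the chain with these holding times.\<close>

section \<open>Natural filtrations\<close>

text \<open>Two obstacles shape the argument. Integrability of \<open>Y\<close> is not at hand, so
  the compensator cannot be treated through expectations of \<open>Y\<close>. The natural filtration
  is not known to be right-continuous, so a strong Markov property at the jump times cannot be
  quoted. Hence the martingale identity is applied only at deterministic times and on events of
  \<open>F u\<close>, and every passage to a random time goes through a grid and dominated
  convergence. The completion deals with the random horizon \<open>- T 1\<close>: the law of a
  cut-off holding time depends on when it starts, whereas the completed sequence has a fixed law.
  Conditioning on \<open>T 1\<close> then means freezing one argument of a function of two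
  independent variables.\<close>

lemma space_natural_filtration [simp]: "space (natural_filtration M I X t) = space M"
  by (simp add: natural_filtration_def space_measure_of_conv)

lemma sets_natural_filtration:
  "sets (natural_filtration M I X t) =
    sigma_sets (space M) {X s -` A \<inter> space M | s A. s \<in> I \<and> s \<le> t}"
  unfolding natural_filtration_def by (rule sets_measure_of) auto

lemma sets_natural_filtration_mono:
  "s \<le> t \<Longrightarrow> sets (natural_filtration M I X s) \<subseteq> sets (natural_filtration M I X t)"
  unfolding sets_natural_filtration by (rule sigma_sets_mono') (auto intro: order_trans)

lemma filtration_natural_filtration: "filtration (space M) (natural_filtration M I X)"
  by standard (simp_all add: sets_natural_filtration_mono)

lemma measurable_natural_filtration:
  assumes "s \<in> I" "s \<le> t"
  shows "X s \<in> measurable (natural_filtration M I X t) (count_space UNIV)"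
proof (rule measurableI)
  fix A :: "nat set"
  show "X s -` A \<inter> space (natural_filtration M I X t) \<in> sets (natural_filtration M I X t)"
    unfolding sets_natural_filtration space_natural_filtration using assms by blast
qed simp

lemma subalgebra_natural_filtration:
  assumes "\<And>s. s \<in> I \<Longrightarrow> s \<le> t \<Longrightarrow> X s \<in> measurable M (count_space UNIV)"
  shows "subalgebra M (natural_filtration M I X t)"
proof -
  have "{X s -` A \<inter> space M | s A. s \<in> I \<and> s \<le> t} \<subseteq> sets M"
    using assms by (auto intro!: measurable_sets)
  then show ?thesis
    unfolding subalgebra_def sets_natural_filtration by (simp add: sets.sigma_sets_subset)
qed

section \<open>Holding times of a compensated counting process\<close>

text \<open>Discrete optional stopping, with \<open>k\<close> the stopping index. The test at
  \<open>i\<close> looks at \<open>P\<close> up to \<open>i\<close> and no further, so that for grid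
  times the coefficient of an increment is known at its left endpoint.\<close>

lemma telescope_until:
  fixes z :: "nat \<Rightarrow> real"
  shows "\<exists>k\<le>m. (\<Sum>i<m. if \<forall>j\<le>i. \<not> P j then z (Suc i) - z i else 0) = z k - z 0 \<and>
    (\<forall>j<k. \<not> P j) \<and> (P k \<or> k = m)"
proof (induction m)
  case (Suc m)
  then obtain k where k: "k \<le> m" "(\<Sum>i<m. if \<forall>j\<le>i. \<not> P j then z (Suc i) - z i else 0) = z k - z 0"
    "\<forall>j<k. \<not> P j" "P k \<or> k = m" by blast
  show ?case
  proof (cases "P k")
    case True
    with k show ?thesis by (intro exI[of _ k]) auto
  next
    case False
    with k have "k = m" by simp
    with k False have "\<forall>j\<le>m. \<not> P j" by (simp add: le_less)
    with k \<open>k = m\<close> show ?thesis by (intro exI[of _ "Suc m"]) (auto simp: less_Suc_eq_le)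
  qed
qed simp

text \<open>\<^term>\<open>Y\<close> counts on the time axis \<open>(-\<infinity>, 0]\<close>, and \<^term>\<open>T n\<close> is the time of its \<open>n\<close>-th jump,
  with \<open>1\<close> standing for a jump that does not occur by time \<open>0\<close>; \<^term>\<open>T 0\<close> carries no meaning.
  The bounds in \<open>drift\<close> are all that is needed of the compensator \<open>\<integral> Y\<^sub>s ds\<close> over \<open>[u, v]\<close>.\<close>

locale compensated_birth = prob_space M for M :: "'a measure" +
  fixes Y :: "real \<Rightarrow> 'a \<Rightarrow> nat" and T :: "nat \<Rightarrow> 'a \<Rightarrow> real" and Z :: "real \<Rightarrow> 'a \<Rightarrow> real"
  assumes Y_measurable: "\<And>u. u \<le> 0 \<Longrightarrow> Y u \<in> measurable M (count_space UNIV)"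
    and T_le_iff: "\<And>\<omega> n u. \<omega> \<in> space M \<Longrightarrow> 1 \<le> n \<Longrightarrow> u \<le> 0 \<Longrightarrow> T n \<omega> \<le> u \<longleftrightarrow> n \<le> Y u \<omega>"
    and Y_T: "\<And>\<omega> n. \<omega> \<in> space M \<Longrightarrow> 1 \<le> n \<Longrightarrow> T n \<omega> \<le> 0 \<Longrightarrow> Y (T n \<omega>) \<omega> = n"
    and T_cases: "\<And>\<omega> n. \<omega> \<in> space M \<Longrightarrow> 1 \<le> n \<Longrightarrow> T n \<omega> \<le> 0 \<or> T n \<omega> = 1"
    and T_1_le: "\<And>\<omega>. \<omega> \<in> space M \<Longrightarrow> T 1 \<omega> \<le> 0"
    and Z_integrable: "\<And>u. u \<le> 0 \<Longrightarrow> integrable M (Z u)"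
    and Z_martingale: "\<And>u v A. u \<le> v \<Longrightarrow> v \<le> 0 \<Longrightarrow> A \<in> sets (natural_filtration M {..0} Y u) \<Longrightarrow>
      (LINT \<omega>:A|M. Z v \<omega>) = (LINT \<omega>:A|M. Z u \<omega>)"
    and drift: "\<And>u v \<omega>. \<omega> \<in> space M \<Longrightarrow> u \<le> v \<Longrightarrow> v \<le> 0 \<Longrightarrow> 1 \<le> Y u \<omega> \<Longrightarrow>
      real (Y v \<omega>) - real (Y u \<omega>) - (Z v \<omega> - Z u \<omega>) \<in> {(v - u) * real (Y u \<omega>) .. (v - u) * real (Y v \<omega>)}"
begin

section \<open>Relations between the states, the jump times and the filtration\<close>

abbreviation F :: "real \<Rightarrow> 'a measure" where
  "F \<equiv> natural_filtration M {..0} Y"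

lemma Y_F: "s \<le> u \<Longrightarrow> u \<le> 0 \<Longrightarrow> Y s \<in> measurable (F u) (count_space UNIV)"
  by (rule measurable_natural_filtration) auto

lemma sets_F_sub: "u \<le> 0 \<Longrightarrow> A \<in> sets (F u) \<Longrightarrow> A \<in> sets M"
  using subalgebra_natural_filtration[of "{..0}" u Y M] Y_measurable
  by (auto simp: subalgebra_def)

lemma sets_F_mono: "u \<le> v \<Longrightarrow> A \<in> sets (F u) \<Longrightarrow> A \<in> sets (F v)"
  using sets_natural_filtration_mono[of u v M "{..0}" Y] by blast

lemma Y_mono:
  assumes "\<omega> \<in> space M" "u \<le> v" "v \<le> 0"
  shows "Y u \<omega> \<le> Y v \<omega>"
proof (cases "Y u \<omega> = 0")
  case False
  then have "T (Y u \<omega>) \<omega> \<le> u" using T_le_iff[of \<omega> "Y u \<omega>" u] assms by simp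
  with assms have "T (Y u \<omega>) \<omega> \<le> v" by simp
  then show ?thesis using T_le_iff[of \<omega> "Y u \<omega>" v] assms False by simp
qed simp

lemma Y_eq_iff:
  assumes "\<omega> \<in> space M" "1 \<le> n" "u \<le> 0"
  shows "Y u \<omega> = n \<longleftrightarrow> T n \<omega> \<le> u \<and> u < T (Suc n) \<omega>"
  using T_le_iff[OF assms] T_le_iff[OF assms(1) _ assms(3), of "Suc n"]
  by (auto simp: not_le[symmetric])

lemma T_strict:
  assumes "\<omega> \<in> space M" "1 \<le> n" "T n \<omega> \<le> 0"
  shows "T n \<omega> < T (Suc n) \<omega>"
  using Y_T[OF assms] Y_eq_iff[OF assms(1,2,3)] by simp

lemma T_mono:
  assumes "\<omega> \<in> space M" "1 \<le> m" "m \<le> n" "T n \<omega> \<le> 0"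
  shows "T m \<omega> \<le> T n \<omega>"
  using T_le_iff[OF assms(1,2,4)] Y_T[OF assms(1) _ assms(4)] assms by simp

lemma T_measurable:
  assumes n: "1 \<le> n"
  shows "T n \<in> borel_measurable M"
  unfolding borel_measurable_iff_le
proof
  fix w :: real
  \<comment> \<open>No jump time lies strictly between 0 and 1, so levels in [0, 1) can be lowered
    to 0, where \<open>T_le_iff\<close> applies; from level 1 on the event is everything.\<close>
  have "{\<omega> \<in> space M. T n \<omega> \<le> w} = (if 1 \<le> w then space M else {\<omega> \<in> space M. n \<le> Y (min w 0) \<omega>})"
  proof (intro set_eqI)
    fix \<omega>
    show "\<omega> \<in> {\<omega> \<in> space M. T n \<omega> \<le> w} \<longleftrightarrow>
        \<omega> \<in> (if 1 \<le> w then space M else {\<omega> \<in> space M. n \<le> Y (min w 0) \<omega>})"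
      using T_le_iff[OF _ n, of \<omega> "min w 0"] T_cases[OF _ n, of \<omega>] by (auto simp: min_def split: if_splits)
  qed
  moreover have "{\<omega> \<in> space M. n \<le> Y (min w 0) \<omega>} \<in> sets M"
    using Y_measurable[of "min w 0"] by measurable
  ultimately show "{\<omega> \<in> space M. T n \<omega> \<le> w} \<in> sets M" by simp
qed

text \<open>\<open>F u\<close> does not tell when jumps after \<open>u\<close> occur, so
  \<open>T n\<close> itself need not be measurable for it; the truncation at \<open>u\<close> is
  what has been observed.\<close>

lemma T_min_F:
  assumes n: "1 \<le> n" and u: "u \<le> 0"
  shows "(\<lambda>\<omega>. min (T n \<omega>) u) \<in> borel_measurable (F u)"
  unfolding borel_measurable_iff_le
proof
  fix w :: real
  have "{\<omega> \<in> space (F u). min (T n \<omega>) u \<le> w} =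
      (if u \<le> w then space (F u) else {\<omega> \<in> space (F u). n \<le> Y (min w u) \<omega>})"
  proof (intro set_eqI)
    fix \<omega>
    show "\<omega> \<in> {\<omega> \<in> space (F u). min (T n \<omega>) u \<le> w} \<longleftrightarrow>
        \<omega> \<in> (if u \<le> w then space (F u) else {\<omega> \<in> space (F u). n \<le> Y (min w u) \<omega>})"
      using T_le_iff[OF _ n, of \<omega> "min w u"] u by (auto simp: min_def split: if_splits)
  qed
  moreover have "{\<omega> \<in> space (F u). n \<le> Y (min w u) \<omega>} \<in> sets (F u)"
    using Y_F[of "min w u" u] u by measurable
  ultimately show "{\<omega> \<in> space (F u). min (T n \<omega>) u \<le> w} \<in> sets (F u)" 
    by (metis (no_types, lifting) sets.top)
qed

lemma less_T_Suc:
  assumes "\<omega> \<in> space M" "1 \<le> n" "u \<le> 0" "Y u \<omega> = n"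
  shows "u < T (Suc n) \<omega>"
  using Y_eq_iff[OF assms(1-3)] assms(4) by simp

text \<open>Stopping at the first grid point at which \<^term>\<open>Y\<close> equals \<open>n + 1\<close>, and at \<open>v\<close> if there is none,
  keeps the stopped values below a constant plus \<open>\<bar>Z v - Z u\<bar>\<close>, so that dominated convergence
  applies although \<^term>\<open>Y v\<close> is not known to be integrable.\<close>

lemma stopped_increment:
  assumes A: "A \<in> sets (F u)" "\<And>\<omega>. \<omega> \<in> A \<Longrightarrow> Y u \<omega> = n" and n: "1 \<le> n" and uv: "u \<le> v" "v \<le> 0"
  shows "(LINT \<omega>:A|M. (if n < Y v \<omega> then 1 else 0) - n * (min (T (Suc n) \<omega>) v - u)) = 0"
proof -
  define s where "s m i = u + (v - u) * real i / real (Suc m)" for m i :: nat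
  have s_mono: "s m i \<le> s m j" if "i \<le> j" for m i j
    unfolding s_def using that uv by (intro add_left_mono divide_right_mono mult_left_mono) auto
  have s_0: "s m 0 = u" for m by (simp add: s_def)
  have s_end: "s m (Suc m) = v" for m by (simp add: s_def)
  have s_bnd: "u \<le> s m i" "i \<le> Suc m \<Longrightarrow> s m i \<le> v" for m i
    using s_mono[of 0 i m] s_mono[of i "Suc m" m] s_0 s_end by auto
  have AM: "A \<in> sets M" using sets_F_sub[OF _ A(1)] uv by simp
  have AS: "\<omega> \<in> space M" if "\<omega> \<in> A" for \<omega> using sets.sets_into_space[OF AM] that by blast
  \<comment> \<open>\<open>B m i\<close> is decided at time \<open>s m i\<close>, so the increment
    of \<open>Z\<close> over the next grid step integrates to 0 on it. The stop waits for exactly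
    the state \<open>n + 1\<close>: if the grid skips that state, the sum runs on to
    \<open>v\<close> and equals \<open>Z v - Z u\<close>, so no bound on \<open>Y v\<close> is
    required.\<close>
  define B where "B m i = {\<omega> \<in> A. \<forall>j\<le>i. Y (s m j) \<omega> \<noteq> Suc n}" for m i
  have B: "B m i \<in> sets (F (s m i))" if "i \<le> Suc m" for m i
  proof -
    have "A \<in> sets (F (s m i))" by (rule sets_F_mono[OF s_bnd(1) A(1)])
    moreover have "{\<omega> \<in> space (F (s m i)). \<forall>j\<in>{..i}. Y (s m j) \<omega> \<noteq> Suc n} \<in> sets (F (s m i))"
    proof (rule sets.sets_Collect_finite_All)
      fix j assume "j \<in> {..i}"
      then have [measurable]: "Y (s m j) \<in> measurable (F (s m i)) (count_space UNIV)"
        using s_mono[of j i m] s_bnd[of i m] uv that by (intro Y_F) auto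
      show "{\<omega> \<in> space (F (s m i)). Y (s m j) \<omega> \<noteq> Suc n} \<in> sets (F (s m i))" by measurable
    qed auto
    moreover have "B m i = A \<inter> {\<omega> \<in> space (F (s m i)). \<forall>j\<in>{..i}. Y (s m j) \<omega> \<noteq> Suc n}"
      using AS by (auto simp: B_def)
    ultimately show ?thesis by simp
  qed
  have BM: "B m i \<in> sets M" if "i \<le> Suc m" for m i
    using sets_F_sub[OF _ B[OF that]] s_bnd(2)[OF that] uv by simp
  define D where "D m \<omega> = (\<Sum>i<Suc m. indicator (B m i) \<omega> * (Z (s m (Suc i)) \<omega> - Z (s m i) \<omega>))" for m \<omega>
  have Z0: "integrable M (Z (s m i))" if "i \<le> Suc m" for m i
    using Z_integrable s_bnd(2)[OF that] uv by (meson order_trans)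
  have ZI: "integrable M (\<lambda>\<omega>. indicator (B m i) \<omega> * Z (s m j) \<omega>)" if "i \<le> Suc m" "j \<le> Suc m" for m i j
    using integrable_mult_indicator[OF BM Z0, of i m j] that by simp
  have D0: "(LINT \<omega>|M. D m \<omega>) = 0" for m
  proof -
    have "(LINT \<omega>|M. D m \<omega>)
        = (\<Sum>i<Suc m. LINT \<omega>|M. indicator (B m i) \<omega> * Z (s m (Suc i)) \<omega> - indicator (B m i) \<omega> * Z (s m i) \<omega>)"
      unfolding D_def right_diff_distrib
      by (intro Bochner_Integration.integral_sum Bochner_Integration.integrable_diff ZI) auto
    also have "\<dots> = (\<Sum>i<Suc m. (LINT \<omega>:B m i|M. Z (s m (Suc i)) \<omega>) - (LINT \<omega>:B m i|M. Z (s m i) \<omega>))"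
      unfolding set_lebesgue_integral_def
      by (intro sum.cong refl) (subst Bochner_Integration.integral_diff, auto intro!: ZI)
    also have "\<dots> = 0"
    proof (intro sum.neutral ballI)
      fix i assume "i \<in> {..<Suc m}"
      then have i: "i \<le> Suc m" "Suc i \<le> Suc m" by auto
      show "(LINT \<omega>:B m i|M. Z (s m (Suc i)) \<omega>) - (LINT \<omega>:B m i|M. Z (s m i) \<omega>) = 0"
        using Z_martingale[OF s_mono[of i "Suc i" m] _ B[OF i(1)]] s_bnd(2)[OF i(2)] uv by simp
    qed
    finally show ?thesis .
  qed
  \<comment> \<open>\<open>f\<close> is the increment of \<open>Z\<close> on \<open>A\<close> from
    \<open>u\<close> to the minimum of the next jump time and \<open>v\<close>: one if the jump
    occurs, minus the drift accumulated at rate \<open>n\<close>.\<close>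
  define f where "f \<omega> = indicator A \<omega> * ((if n < Y v \<omega> then 1 else 0) - n * (min (T (Suc n) \<omega>) v - u))" for \<omega>
  \<comment> \<open>At a grid point \<open>s\<close> in state \<open>n + 1\<close> the drift bounds
    give \<open>1 - (s - u) (n + 1) <= Z s - Z u <= 1 - (s - u) n\<close>; this is the source of
    \<open>C\<close>.\<close>
  define C where "C = 1 + (n + 1) * (v - u)"
  have C: "0 \<le> C" using uv by (simp add: C_def)
  have ex: "\<exists>k\<le>Suc m. D m \<omega> = Z (s m k) \<omega> - Z u \<omega> \<and> (\<forall>j<k. Y (s m j) \<omega> \<noteq> Suc n) \<and>
      (Y (s m k) \<omega> = Suc n \<or> k = Suc m)" if "\<omega> \<in> A" for m \<omega>
  proof -
    have "D m \<omega> = (\<Sum>i<Suc m. if \<forall>j\<le>i. \<not> Y (s m j) \<omega> = Suc n then Z (s m (Suc i)) \<omega> - Z (s m i) \<omega> else 0)"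
      unfolding D_def using that by (intro sum.cong refl) (auto simp: B_def)
    then show ?thesis
      using telescope_until[of "Suc m" "\<lambda>j. Y (s m j) \<omega> = Suc n" "\<lambda>i. Z (s m i) \<omega>"] s_0 by metis
  qed
  have D_out: "D m \<omega> = 0" if "\<omega> \<notin> A" for m \<omega>
    using that by (simp add: D_def B_def)
  have bound: "\<bar>D m \<omega>\<bar> \<le> \<bar>Z v \<omega> - Z u \<omega>\<bar> + C" for m \<omega>
  proof (cases "\<omega> \<in> A")
    case True
    obtain k where k: "k \<le> Suc m" "D m \<omega> = Z (s m k) \<omega> - Z u \<omega>"
      "Y (s m k) \<omega> = Suc n \<or> k = Suc m" using ex[OF True] by blast
    show ?thesis
    proof (cases "k = Suc m")
      case True then show ?thesis using k C s_end by simp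
    next
      case False
      with k have Yk: "Y (s m k) \<omega> = Suc n" by simp
      have "(s m k - u) * real (Suc n) \<le> (v - u) * real (Suc n)"
        using s_bnd(2)[OF k(1)] by (intro mult_right_mono) auto
      moreover have "0 \<le> (s m k - u) * real n" using s_bnd(1) by simp
      moreover have "Suc n - n - (Z (s m k) \<omega> - Z u \<omega>) \<in> {(s m k - u) * n .. (s m k - u) * Suc n}"
        using drift[OF AS[OF True] s_bnd(1), of m k] s_bnd(2)[OF k(1)] uv n Yk A(2)[OF True] by simp
      ultimately have "\<bar>Z (s m k) \<omega> - Z u \<omega>\<bar> \<le> C"
        unfolding C_def by (auto simp: abs_le_iff algebra_simps)
      then show ?thesis using k by simp
    qed
  qed (use C D_out in simp)
  have lim: "(\<lambda>m. D m \<omega>) \<longlonglongrightarrow> f \<omega>" for \<omega>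
  proof (cases "\<omega> \<in> A")
    case False
    then show ?thesis by (simp add: D_out f_def)
  next
    case wA: True
    have wS: "\<omega> \<in> space M" and Yu: "Y u \<omega> = n" using AS A(2) wA by auto
    have uT: "u < T (Suc n) \<omega>" using less_T_Suc[OF wS n _ Yu] uv by simp
    show ?thesis
    proof (cases "n < Y v \<omega>")
      case False
      then have Yv: "Y v \<omega> = n" using Y_mono[OF wS uv] Yu by simp
      \<comment> \<open>Without a jump the grid never shows \<open>n + 1\<close>, so the sum runs to
        \<open>v\<close>; as \<open>Y u = Y v = n\<close>, the two drift bounds coincide and the
        value is exact for every \<open>m\<close>.\<close>
      have "D m \<omega> = f \<omega>" for m
      proof -
        obtain k where k: "k \<le> Suc m" "D m \<omega> = Z (s m k) \<omega> - Z u \<omega>"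
          "Y (s m k) \<omega> = Suc n \<or> k = Suc m" using ex[OF wA] by blast
        have "Y (s m k) \<omega> \<le> n" using Y_mono[OF wS s_bnd(2)[OF k(1)]] uv Yv by simp
        then have "s m k = v" using k(3) s_end by simp
        moreover have "v < T (Suc n) \<omega>" using less_T_Suc[OF wS n uv(2) Yv] .
        ultimately show ?thesis
          using k drift[OF wS uv] n Yu Yv wA by (simp add: f_def algebra_simps)
      qed
      then show ?thesis by simp
    next
      case True
      define \<tau> where "\<tau> = T (Suc n) \<omega>"
      have tv: "\<tau> \<le> v" using T_le_iff[OF wS _ uv(2), of "Suc n"] True by (simp add: \<tau>_def)
      have ut: "u < \<tau>" using uT by (simp add: \<tau>_def)
      have tT: "\<tau> < T (Suc (Suc n)) \<omega>" using T_strict[OF wS, of "Suc n"] tv uv by (simp add: \<tau>_def)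
      have Y_between: "Y w \<omega> = n" if "u \<le> w" "w < \<tau>" for w
        using Y_eq_iff[OF wS n, of w] Y_eq_iff[OF wS n, of u] Yu that tv uv by (simp add: \<tau>_def)
      have key: "\<bar>(Z w \<omega> - Z u \<omega>) - (1 - n * (\<tau> - u))\<bar> \<le> (n + 1) * (w - \<tau>)"
        if w: "\<tau> \<le> w" "w \<le> v" "Y w \<omega> = Suc n" for w
      proof -
        have d1: "Suc n - n - (Z w \<omega> - Z u \<omega>) \<in> {(w - u) * n .. (w - u) * Suc n}"
          using drift[OF wS, of u w] w ut uv n Yu by simp
        \<comment> \<open>On \<open>[u, x]\<close> with \<open>x < \<tau>\<close> the state is
          constantly \<open>n\<close> and the drift is exact; only \<open>[x, w]\<close> costs an
          error. Letting \<open>x\<close> increase to \<open>\<tau>\<close> leaves the error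
          \<open>(n + 1) (w - \<tau>)\<close>.\<close>
        have d2: "x \<le> (n + 1) * w - n * u - (1 - (Z w \<omega> - Z u \<omega>))" if "u < x" "x < \<tau>" for x
        proof -
          have "n - n - (Z x \<omega> - Z u \<omega>) \<in> {(x - u) * n .. (x - u) * n}"
            using drift[OF wS, of u x] that tv uv n Yu Y_between[of x] by simp
          moreover have "Suc n - n - (Z w \<omega> - Z x \<omega>) \<in> {(w - x) * n .. (w - x) * Suc n}"
            using drift[OF wS, of x w] that w tv uv n Y_between[of x] by simp
          ultimately show ?thesis by (simp add: algebra_simps)
        qed
        have "\<tau> \<le> (n + 1) * w - n * u - (1 - (Z w \<omega> - Z u \<omega>))"
          using d2 ut by (intro dense_le_bounded[of u \<tau>]) auto
        moreover have "0 \<le> (w - \<tau>) * n" "0 \<le> w - \<tau>" using w by simp_all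
        ultimately show ?thesis using d1 unfolding abs_le_iff by (auto simp: algebra_simps)
      qed
      \<comment> \<open>Once the mesh is below the gap \<open>\<epsilon>\<close> to the jump after
        \<open>\<tau>\<close>, the first grid point at or after \<open>\<tau>\<close> still sees the
        state \<open>n + 1\<close>, so the stop happens within one mesh width after
        \<open>\<tau>\<close>.\<close>
      define \<epsilon> where "\<epsilon> = T (Suc (Suc n)) \<omega> - \<tau>"
      have eps: "\<epsilon> > 0" using tT by (simp add: \<epsilon>_def)
      have small: "(\<lambda>m. (v - u) / real (Suc m)) \<longlonglongrightarrow> 0"
        by (rule LIMSEQ_Suc[OF lim_const_over_n])
      have ev: "\<forall>\<^sub>F m in sequentially. (v - u) / real (Suc m) < \<epsilon>"
        using order_tendstoD(2)[OF small eps] .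
      have "\<forall>\<^sub>F m in sequentially. \<bar>D m \<omega> - f \<omega>\<bar> \<le> (n + 1) * ((v - u) / real (Suc m))"
        using ev
      proof eventually_elim
        case (elim m)
        define \<delta> where "\<delta> = (v - u) / real (Suc m)"
        have d: "\<delta> > 0" using ut tv by (simp add: \<delta>_def)
        define i where "i = nat \<lceil>(\<tau> - u) / \<delta>\<rceil>"
        have s_eq: "s m j = u + j * \<delta>" for j by (simp add: s_def \<delta>_def)
        have "(\<tau> - u) / \<delta> > 0" using ut d by simp
        then have i1: "(\<tau> - u) / \<delta> \<le> i" "i < (\<tau> - u) / \<delta> + 1"
          unfolding i_def by linarith+
        have s1: "\<tau> \<le> s m i" "s m i < \<tau> + \<delta>"
          using i1 d by (simp_all add: s_eq field_simps)
        have "(\<tau> - u) / \<delta> \<le> Suc m"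
        proof -
          have "real (Suc m) * \<delta> = v - u" by (simp add: \<delta>_def)
          then show ?thesis unfolding pos_divide_le_eq[OF d] using tv by linarith
        qed
        then have iS: "i \<le> Suc m" unfolding i_def by linarith
        have Yi: "Y (s m i) \<omega> = Suc n"
        proof -
          have "\<delta> < \<epsilon>" using elim by (simp add: \<delta>_def)
          then have "s m i < T (Suc (Suc n)) \<omega>" using s1 by (simp add: \<epsilon>_def)
          then show ?thesis
            using Y_eq_iff[OF wS, of "Suc n" "s m i"] s1 s_bnd(2)[OF iS] uv by (simp add: \<tau>_def)
        qed
        obtain k where k: "k \<le> Suc m" "D m \<omega> = Z (s m k) \<omega> - Z u \<omega>"
          "\<forall>j<k. Y (s m j) \<omega> \<noteq> Suc n" "Y (s m k) \<omega> = Suc n \<or> k = Suc m" using ex[OF wA] by blast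
        have ki: "k \<le> i"
        proof (rule ccontr)
          assume "\<not> k \<le> i"
          then show False using k(3) Yi by simp
        qed
        have Yk: "Y (s m k) \<omega> = Suc n"
        proof (cases "k = Suc m")
          case True
          with ki iS have "k = i" by simp
          then show ?thesis using Yi by simp
        qed (use k(4) in simp)
        have sk: "s m k \<le> v" "s m k < \<tau> + \<delta>" using s_bnd(2)[OF k(1)] s_mono[OF ki, of m] s1 by auto
        have tk: "\<tau> \<le> s m k"
          using Y_eq_iff[OF wS, of "Suc n" "s m k"] Yk sk uv by (simp add: \<tau>_def)
        have "f \<omega> = 1 - n * (\<tau> - u)" using True wA tv by (simp add: f_def \<tau>_def)
        then have "\<bar>D m \<omega> - f \<omega>\<bar> \<le> (n + 1) * (s m k - \<tau>)"
          using key[OF tk sk(1) Yk] unfolding k(2) by simp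
        also have "\<dots> \<le> (n + 1) * \<delta>" using sk by (intro mult_left_mono) auto
        finally show ?case by (simp add: \<delta>_def)
      qed
      moreover have "(\<lambda>m. (n + 1) * ((v - u) / real (Suc m))) \<longlonglongrightarrow> 0"
        using tendsto_mult_right_zero[OF small] by simp
      ultimately have "(\<lambda>m. D m \<omega> - f \<omega>) \<longlonglongrightarrow> 0"
        by (intro Lim_null_comparison[where f="\<lambda>m. D m \<omega> - f \<omega>"]) simp_all
      then show ?thesis by (simp add: LIM_zero_iff)
    qed
  qed
  have Dm: "D m \<in> borel_measurable M" for m
    unfolding D_def using BM Z0
    by (intro borel_measurable_sum borel_measurable_times borel_measurable_diff
        borel_measurable_indicator) (auto intro: borel_measurable_integrable)
  have fm: "f \<in> borel_measurable M"
    by (rule borel_measurable_LIMSEQ_real[OF lim Dm])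
  have "(\<lambda>m. LINT \<omega>|M. D m \<omega>) \<longlonglongrightarrow> (LINT \<omega>|M. f \<omega>)"
  proof (rule integral_dominated_convergence[where w="\<lambda>\<omega>. \<bar>Z v \<omega> - Z u \<omega>\<bar> + C"])
    show "integrable M (\<lambda>\<omega>. \<bar>Z v \<omega> - Z u \<omega>\<bar> + C)"
      using Z_integrable[of u] Z_integrable[of v] uv by auto
  qed (use fm Dm lim bound in auto)
  then have "(LINT \<omega>|M. f \<omega>) = 0" by (simp add: D0 LIMSEQ_const_iff)
  then show ?thesis by (simp add: f_def[abs_def] set_lebesgue_integral_def)
qed

section \<open>Exponential decay of the probability of staying in a state\<close>

text \<open>The probability lost between \<open>r\<close> and \<open>v\<close> is that of a jump in
  between. By \<open>stopped_increment\<close>, started at \<open>r\<close> from the event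
  \<open>B r\<close>, it equals \<open>n\<close> times the expected time spent in state
  \<open>n\<close> during \<open>[r, v]\<close>. This time is at most \<open>v - r\<close>, and it
  is \<open>v - r\<close> on the paths still in state \<open>n\<close> at \<open>v\<close>.\<close>

lemma stay_prob_step:
  assumes A: "A \<in> sets (F u)" "\<And>\<omega>. \<omega> \<in> A \<Longrightarrow> Y u \<omega> = n" and n: "1 \<le> n"
    and uv: "u \<le> r" "r \<le> v" "v \<le> 0"
  defines "p \<equiv> \<lambda>w. prob (A \<inter> {\<omega>. Y w \<omega> = n})"
  shows "real n * (v - r) * p v \<le> p r - p v" "p r - p v \<le> real n * (v - r) * p r"
proof -
  have AM: "A \<in> sets M" using sets_F_sub[OF _ A(1)] uv by simp
  have AS: "\<omega> \<in> space M" if "\<omega> \<in> A" for \<omega> using sets.sets_into_space[OF AM] that by blast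
  define B where "B w = A \<inter> {\<omega>. Y w \<omega> = n}" for w
  have B: "B w \<in> sets (F w)" if "u \<le> w" "w \<le> 0" for w
  proof -
    have [measurable]: "Y w \<in> measurable (F w) (count_space UNIV)" using that by (intro Y_F) auto
    have "{\<omega> \<in> space (F w). Y w \<omega> = n} \<in> sets (F w)" by measurable
    moreover have "B w = A \<inter> {\<omega> \<in> space (F w). Y w \<omega> = n}" using AS by (auto simp: B_def)
    ultimately show ?thesis using sets_F_mono[OF that(1) A(1)] by simp
  qed
  have BM: "B w \<in> sets M" if "u \<le> w" "w \<le> 0" for w using sets_F_sub[OF that(2) B[OF that]] .
  have BM': "B r \<in> sets M" "B v \<in> sets M" using BM uv by auto
  have sub: "B v \<subseteq> B r"
  proof
    fix \<omega> assume \<omega>: "\<omega> \<in> B v"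
    then show "\<omega> \<in> B r"
      using Y_mono[of \<omega> u r] Y_mono[of \<omega> r v] AS A(2)[of \<omega>] uv by (auto simp: B_def)
  qed
  define g where "g \<omega> = real n * (min (T (Suc n) \<omega>) v - r)" for \<omega>
  have Tn [measurable]: "T (Suc n) \<in> borel_measurable M" by (rule T_measurable) simp
  have gB: "0 \<le> g \<omega>" "g \<omega> \<le> real n * (v - r)" if "\<omega> \<in> B r" for \<omega>
    using less_T_Suc[of \<omega> n r] AS that n uv by (auto simp: g_def B_def intro!: mult_left_mono)
  have int_ind: "integrable M (\<lambda>\<omega>. indicator (B r - B v) \<omega> :: real)"
    using BM' by (intro integrable_real_indicator) (auto simp: emeasure_eq_measure)
  have int_c: "integrable M (\<lambda>\<omega>. indicator (B w) \<omega> * c)" if "B w \<in> sets M" for w and c :: real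
    using that by (intro integrable_mult_left integrable_real_indicator) (auto simp: emeasure_eq_measure)
  have int_g: "integrable M (\<lambda>\<omega>. indicator (B r) \<omega> * g \<omega>)"
  proof (rule integrable_const_bound[where B="real n * (v - r)"])
    show "(\<lambda>\<omega>. indicator (B r) \<omega> * g \<omega>) \<in> borel_measurable M"
      unfolding g_def using BM' by measurable
    show "AE \<omega> in M. norm (indicator (B r) \<omega> * g \<omega>) \<le> real n * (v - r)"
      using gB uv by (intro AE_I2) (auto simp: indicator_def)
  qed
  have "(LINT \<omega>:B r|M. (if n < Y v \<omega> then 1 else 0) - real n * (min (T (Suc n) \<omega>) v - r)) = 0"
    using stopped_increment[of "B r" r n v, OF B _ n uv(2,3)] uv by (auto simp: B_def)
  also have "(LINT \<omega>:B r|M. (if n < Y v \<omega> then 1 else 0) - real n * (min (T (Suc n) \<omega>) v - r))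
      = (LINT \<omega>|M. indicator (B r - B v) \<omega> - indicator (B r) \<omega> * g \<omega>)"
    unfolding set_lebesgue_integral_def
  proof (intro Bochner_Integration.integral_cong refl)
    fix \<omega> assume \<omega>: "\<omega> \<in> space M"
    show "indicator (B r) \<omega> *\<^sub>R ((if n < Y v \<omega> then 1 else 0) - real n * (min (T (Suc n) \<omega>) v - r))
        = indicator (B r - B v) \<omega> - indicator (B r) \<omega> * g \<omega>"
      using Y_mono[OF \<omega> uv(2,3)] by (auto simp: B_def g_def indicator_def)
  qed
  also have "\<dots> = prob (B r - B v) - (LINT \<omega>|M. indicator (B r) \<omega> * g \<omega>)"
    using int_ind int_g BM' by (subst Bochner_Integration.integral_diff) auto
  also have "prob (B r - B v) = p r - p v"
    using finite_measure_Diff[OF BM' sub] by (simp add: p_def B_def)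
  finally have eq: "p r - p v = (LINT \<omega>|M. indicator (B r) \<omega> * g \<omega>)" by simp
  have "(LINT \<omega>|M. indicator (B r) \<omega> * g \<omega>) \<le> (LINT \<omega>|M. indicator (B r) \<omega> * (real n * (v - r)))"
    using gB by (intro integral_mono int_g int_c BM') (auto simp: indicator_def)
  also have "\<dots> = real n * (v - r) * p r" using BM' by (simp add: p_def B_def)
  finally show "p r - p v \<le> real n * (v - r) * p r" using eq by simp
  have "real n * (v - r) * p v = (LINT \<omega>|M. indicator (B v) \<omega> * (real n * (v - r)))"
    using BM' by (simp add: p_def B_def)
  also have "\<dots> \<le> (LINT \<omega>|M. indicator (B r) \<omega> * g \<omega>)"
  proof (rule integral_mono)
    fix \<omega> assume "\<omega> \<in> space M"
    then show "indicator (B v) \<omega> * (real n * (v - r)) \<le> indicator (B r) \<omega> * g \<omega>"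
    proof (cases "\<omega> \<in> B v")
      case True
      then show ?thesis
        using less_T_Suc[of \<omega> n v] sub \<open>\<omega> \<in> space M\<close> n uv by (auto simp: g_def B_def)
    next
      case False
      then show ?thesis using gB(1)[of \<omega>] by (simp add: indicator_def)
    qed
  qed (intro int_c int_g BM')+
  finally show "real n * (v - r) * p v \<le> p r - p v" using eq by simp
qed

text \<open>Compounding takes the place of derivatives: over \<open>m\<close> equal steps the two
  bounds become \<open>p v (1 + c/m)^m <= p u\<close> and \<open>p u (1 - c/m)^m <= p v\<close> with
  \<open>c = n (v - u)\<close>, and both factors converge to exponentials.\<close>

lemma stay_prob:
  assumes A: "A \<in> sets (F u)" "\<And>\<omega>. \<omega> \<in> A \<Longrightarrow> Y u \<omega> = n" and n: "1 \<le> n" and uv: "u \<le> v" "v \<le> 0"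
  shows "prob (A \<inter> {\<omega>. Y v \<omega> = n}) = exp (- (real n * (v - u))) * prob A"
proof -
  define p where "p w = prob (A \<inter> {\<omega>. Y w \<omega> = n})" for w
  define c where "c = real n * (v - u)"
  have c: "0 \<le> c" using uv by (simp add: c_def)
  have Au: "A \<inter> {\<omega>. Y u \<omega> = n} = A" using A(2) by blast
  have step: "real n * (v' - r) * p v' \<le> p r - p v'" "p r - p v' \<le> real n * (v' - r) * p r"
    if "u \<le> r" "r \<le> v'" "v' \<le> 0" for r v'
    unfolding p_def using stay_prob_step[OF A n that] by auto
  have p_nonneg: "0 \<le> p w" for w by (simp add: p_def)
  \<comment> \<open>\<open>c <= m\<close> keeps \<open>1 - c/m\<close> nonnegative, so that the
    lower bound can be multiplied up in the induction.\<close>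
  have iter: "p v * (1 + c / m) ^ m \<le> p u \<and> p u * (1 - c / m) ^ m \<le> p v" if m: "m > 0" "c \<le> m" for m :: nat
  proof -
    define s where "s i = u + (v - u) * real i / m" for i :: nat
    have s: "u \<le> s i" "s i \<le> s (Suc i)" "s (Suc i) \<le> 0" if "i < m" for i
    proof -
      show "u \<le> s i" using uv by (simp add: s_def)
      show "s i \<le> s (Suc i)" unfolding s_def
        using uv by (intro add_left_mono divide_right_mono mult_left_mono) auto
      have "(v - u) * real (Suc i) / m \<le> (v - u) * m / m"
        using uv that by (intro divide_right_mono mult_left_mono) auto
      then show "s (Suc i) \<le> 0" using m uv by (simp add: s_def)
    qed
    have ds: "real n * (s (Suc i) - s i) = c / m" for i
      by (simp add: s_def c_def add_divide_distrib diff_divide_distrib algebra_simps)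
    have "i \<le> m \<Longrightarrow> p (s i) * (1 + c / m) ^ i \<le> p u \<and> p u * (1 - c / m) ^ i \<le> p (s i)" for i
    proof (induction i)
      case 0
      then show ?case by (simp add: s_def)
    next
      case (Suc i)
      have d: "c / m * p (s (Suc i)) \<le> p (s i) - p (s (Suc i))"
        "p (s i) - p (s (Suc i)) \<le> c / m * p (s i)"
        using step[OF s[of i]] Suc.prems ds[of i] by auto
      have "p (s (Suc i)) * (1 + c / m) \<le> p (s i)" using d by (simp add: algebra_simps)
      then have "(p (s (Suc i)) * (1 + c / m)) * (1 + c / m) ^ i \<le> p (s i) * (1 + c / m) ^ i"
        using c by (intro mult_right_mono) auto
      moreover have "(p u * (1 - c / m) ^ i) * (1 - c / m) \<le> p (s i) * (1 - c / m)"
        using Suc c m by (intro mult_right_mono) auto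
      moreover have "p (s i) * (1 - c / m) \<le> p (s (Suc i))" using d by (simp add: algebra_simps)
      ultimately show ?case using Suc by (simp add: mult_ac)
    qed
    from this[of m] show ?thesis using m by (simp add: s_def)
  qed
  have ev: "\<forall>\<^sub>F m in sequentially. m > 0 \<and> c \<le> real m"
    using eventually_gt_at_top[of 0] eventually_ge_at_top[of "nat \<lceil>c\<rceil>"]
    by eventually_elim linarith
  have "p v * exp c \<le> p u"
  proof (rule tendsto_upperbound)
    show "(\<lambda>m. p v * (1 + c / m) ^ m) \<longlonglongrightarrow> p v * exp c"
      by (intro tendsto_intros tendsto_exp_limit_sequentially)
    show "\<forall>\<^sub>F m in sequentially. p v * (1 + c / real m) ^ m \<le> p u"
      using ev by eventually_elim (use iter in blast)
  qed simp
  moreover have "p u * exp (- c) \<le> p v"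
  proof (rule tendsto_upperbound)
    show "(\<lambda>m. p u * (1 - c / m) ^ m) \<longlonglongrightarrow> p u * exp (- c)"
      using tendsto_mult_left[OF tendsto_exp_limit_sequentially[of "- c"]] by simp
    show "\<forall>\<^sub>F m in sequentially. p u * (1 - c / real m) ^ m \<le> p v"
      using ev by eventually_elim (use iter in blast)
  qed simp
  ultimately have "p v = exp (- c) * p u" by (simp add: exp_minus field_simps)
  then show ?thesis by (simp add: p_def c_def Au)
qed

section \<open>The holding time counted from a jump time\<close>

text \<open>Evaluating \<open>Y\<close> at a random time would call for joint measurability in time
  and \<open>\<omega>\<close>; expressing the state through the two adjacent jump times avoids
  it.\<close>

lemma Y_random_eq_measurable:
  assumes n: "1 \<le> n" and W: "W \<in> borel_measurable M" "\<And>\<omega>. \<omega> \<in> space M \<Longrightarrow> W \<omega> \<le> 0"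
  shows "{\<omega> \<in> space M. Y (W \<omega>) \<omega> = n} \<in> sets M"
proof -
  note [measurable] = W(1) T_measurable[OF n] T_measurable[of "Suc n", simplified]
  have "{\<omega> \<in> space M. Y (W \<omega>) \<omega> = n} = {\<omega> \<in> space M. T n \<omega> \<le> W \<omega> \<and> W \<omega> < T (Suc n) \<omega>}"
    using Y_eq_iff[OF _ n W(2)] by blast
  then show ?thesis by simp
qed

text \<open>The exponential weight is the probability that an independent exponential variable of rate \<open>n\<close>
  exceeds the part of the waiting time \<open>a\<close> that falls after time \<open>0\<close>.\<close>

lemma stay_prob_from_jump:
  assumes n: "1 \<le> n" and a: "0 \<le> a" and CM: "C \<in> sets M" and C0: "\<And>\<omega>. \<omega> \<in> C \<Longrightarrow> T n \<omega> \<le> 0"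
    and CF: "\<And>u. u \<le> 0 \<Longrightarrow> C \<inter> {\<omega>. T n \<omega> \<le> u} \<in> sets (F u)"
  shows "(LINT \<omega>:C|M. if Y (min (T n \<omega> + a) 0) \<omega> = n then exp (- (real n * max 0 (a + T n \<omega>))) else 0)
    = exp (- (real n * a)) * prob C"
proof -
  have CS: "\<omega> \<in> space M" if "\<omega> \<in> C" for \<omega> using sets.sets_into_space[OF CM] that by blast
  \<comment> \<open>\<open>q x\<close> is the integrand with the jump time replaced by
    \<open>x\<close>, so that grid approximations of \<open>T n\<close> can be inserted.\<close>
  define q where "q x \<omega> = (if Y (min (x + a) 0) \<omega> = n then exp (- (real n * max 0 (a + x))) else 0)" for x \<omega>
  \<comment> \<open>The grid starts at 0 and runs backwards with mesh \<open>1 / (m + 1)\<close>, so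
    that it covers the whole half-line.\<close>
  define s where "s m i = - (real i / real (Suc m))" for m i :: nat
  \<comment> \<open>The \<open>n\<close>-th jump falls into the cell
    \<open>(s m (Suc i), s m i]\<close> and is the last one by \<open>s m i\<close>: at this
    deterministic time the event is known and the state is \<open>n\<close>, as
    \<open>stay_prob\<close> demands. Paths with a further jump in the same cell are dropped; they
    disappear in the limit.\<close>
  define D where "D m i = {\<omega> \<in> C. T n \<omega> \<le> s m i \<and> Y (s m (Suc i)) \<omega> < n \<and> Y (s m i) \<omega> = n}" for m i
  have s0: "s m i \<le> 0" and s_anti: "s m (Suc i) \<le> s m i" for m i
    by (auto simp: s_def divide_right_mono)
  have DF: "D m i \<in> sets (F (s m i))" for m i
  proof -
    have [measurable]: "Y (s m i) \<in> measurable (F (s m i)) (count_space UNIV)"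
      "Y (s m (Suc i)) \<in> measurable (F (s m i)) (count_space UNIV)"
      by (intro Y_F s0 s_anti order_refl)+
    have "{\<omega> \<in> space (F (s m i)). Y (s m (Suc i)) \<omega> < n \<and> Y (s m i) \<omega> = n} \<in> sets (F (s m i))"
      by measurable
    moreover have "D m i = (C \<inter> {\<omega>. T n \<omega> \<le> s m i}) \<inter>
        {\<omega> \<in> space (F (s m i)). Y (s m (Suc i)) \<omega> < n \<and> Y (s m i) \<omega> = n}"
      using CS by (auto simp: D_def)
    ultimately show ?thesis using CF[OF s0] by simp
  qed
  have DM [measurable]: "D m i \<in> sets M" for m i using sets_F_sub[OF s0 DF] .
  \<comment> \<open>The grid point at or just after \<open>T n\<close>: the floor is taken of a
    multiple of \<open>- T n\<close>, so the rounding goes towards 0.\<close>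
  define \<tau> where "\<tau> m \<omega> = s m (nat \<lfloor>- T n \<omega> * real (Suc m)\<rfloor>)" for m \<omega>
  have \<tau>D: "\<tau> m \<omega> = s m i" if "\<omega> \<in> D m i" for m i \<omega>
  proof -
    have "T n \<omega> \<le> s m i" "\<not> T n \<omega> \<le> s m (Suc i)"
      using that T_le_iff[OF CS n s0, of \<omega> m "Suc i"] by (auto simp: D_def)
    then have "real i \<le> - T n \<omega> * real (Suc m)" "- T n \<omega> * real (Suc m) < real i + 1"
      by (auto simp: s_def field_simps)
    then have "\<lfloor>- T n \<omega> * real (Suc m)\<rfloor> = int i" by (simp add: floor_eq_iff)
    then show ?thesis by (simp add: \<tau>_def)
  qed
  have disj: "disjoint_family (D m)" for m
    unfolding disjoint_family_on_def
  proof (intro ballI impI)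
    fix i j :: nat assume "i \<noteq> j"
    then show "D m i \<inter> D m j = {}"
      using \<tau>D[of _ m i] \<tau>D[of _ m j] by (fastforce simp: s_def)
  qed
  define U where "U m = (\<Union>i. D m i)" for m
  have UM [measurable]: "U m \<in> sets M" for m by (auto simp: U_def)
  have UC: "U m \<subseteq> C" for m by (auto simp: U_def D_def)
  have Tn [measurable]: "T n \<in> borel_measurable M" by (rule T_measurable[OF n])
  have \<tau>0: "\<tau> m \<omega> \<le> 0" for m \<omega> by (simp add: \<tau>_def s0)
  have [measurable]: "\<tau> m \<in> borel_measurable M" for m
    unfolding \<tau>_def s_def by measurable
  have qM: "(\<lambda>\<omega>. q (W \<omega>) \<omega>) \<in> borel_measurable M" if [measurable]: "W \<in> borel_measurable M" for W
  proof -
    have [measurable]: "{\<omega> \<in> space M. Y (min (W \<omega> + a) 0) \<omega> = n} \<in> sets M"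
      by (rule Y_random_eq_measurable[OF n]) simp_all
    show ?thesis unfolding q_def by measurable
  qed
  have q01: "0 \<le> q x \<omega>" "q x \<omega> \<le> 1" for x \<omega> by (auto simp: q_def)
  have qi: "set_integrable M A (\<lambda>\<omega>. q (W \<omega>) \<omega>)"
    if [measurable]: "A \<in> sets M" and W: "W \<in> borel_measurable M" for A W
    unfolding set_integrable_def using qM[OF W] q01
    by (intro integrable_const_bound[where B=1]) (auto simp: indicator_def)
  have int_U: "(LINT \<omega>:U m|M. q (\<tau> m \<omega>) \<omega>) = exp (- (real n * a)) * prob (U m)" for m
  proof -
    have "(LINT \<omega>:U m|M. q (\<tau> m \<omega>) \<omega>) = (\<Sum>i. LINT \<omega>:D m i|M. q (\<tau> m \<omega>) \<omega>)"
      unfolding U_def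
      using lebesgue_integral_countable_add[of "D m" M "\<lambda>\<omega>. q (\<tau> m \<omega>) \<omega>"] disj[of m] qi[of "U m" "\<tau> m"]
      by (auto simp: U_def disjoint_family_on_def)
    also have "(\<lambda>i. LINT \<omega>:D m i|M. q (\<tau> m \<omega>) \<omega>) = (\<lambda>i. exp (- (real n * a)) * prob (D m i))"
    proof
      fix i
      define w where "w = min (s m i + a) 0"
      have w: "s m i \<le> w" "w \<le> 0" using a s0[of m i] by (auto simp: w_def)
      have [measurable]: "Y w \<in> measurable M (count_space UNIV)" by (rule Y_measurable[OF w(2)])
      have DwM: "D m i \<inter> {\<omega>. Y w \<omega> = n} \<in> sets M"
      proof -
        have "D m i \<inter> {\<omega>. Y w \<omega> = n} = D m i \<inter> {\<omega> \<in> space M. Y w \<omega> = n}"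
          using CS by (auto simp: D_def)
        then show ?thesis by simp
      qed
      have "(LINT \<omega>:D m i|M. q (\<tau> m \<omega>) \<omega>)
          = (LINT \<omega>|M. indicator (D m i \<inter> {\<omega>. Y w \<omega> = n}) \<omega> * exp (- (real n * max 0 (a + s m i))))"
        unfolding set_lebesgue_integral_def
        by (intro Bochner_Integration.integral_cong refl) (auto simp: indicator_def q_def w_def \<tau>D)
      also have "\<dots> = prob (D m i \<inter> {\<omega>. Y w \<omega> = n}) * exp (- (real n * max 0 (a + s m i)))"
        using DwM by simp
      also have "prob (D m i \<inter> {\<omega>. Y w \<omega> = n}) = exp (- (real n * (w - s m i))) * prob (D m i)"
        by (rule stay_prob[OF DF _ n w]) (simp add: D_def)
      also have "exp (- (real n * (w - s m i))) * prob (D m i) * exp (- (real n * max 0 (a + s m i)))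
          = exp (- (real n * (w - s m i)) + - (real n * max 0 (a + s m i))) * prob (D m i)"
        by (simp only: exp_add mult_ac)
      \<comment> \<open>The waiting time \<open>a\<close> splits into a part before time 0, during
        which the process stays in \<open>n\<close>, and a part after 0, which the weight accounts
        for. The exponents add up to the same value in every cell.\<close>
      also have "- (real n * (w - s m i)) + - (real n * max 0 (a + s m i)) = - (real n * a)"
        by (auto simp: w_def min_def max_def algebra_simps)
      finally show "(LINT \<omega>:D m i|M. q (\<tau> m \<omega>) \<omega>) = exp (- (real n * a)) * prob (D m i)" .
    qed
    also have "(\<Sum>i. exp (- (real n * a)) * prob (D m i)) = exp (- (real n * a)) * prob (U m)"
    proof -
      have "range (D m) \<subseteq> sets M" by auto
      from sums_mult[OF finite_measure_UNION[OF this disj]] show ?thesis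
        unfolding U_def by (rule sums_unique[symmetric])
    qed
    finally show ?thesis .
  qed
  have conv: "\<forall>\<^sub>F m in sequentially. \<omega> \<in> U m \<and>
      Y (min (\<tau> m \<omega> + a) 0) \<omega> = Y (min (T n \<omega> + a) 0) \<omega>" and \<tau>lim: "(\<lambda>m. \<tau> m \<omega>) \<longlonglongrightarrow> T n \<omega>"
    if wC: "\<omega> \<in> C" for \<omega>
  proof -
    have wS: "\<omega> \<in> space M" and T0: "T n \<omega> \<le> 0" using CS C0 wC by auto
    have \<tau>bnd: "T n \<omega> \<le> \<tau> m \<omega>" "\<tau> m \<omega> < T n \<omega> + 1 / real (Suc m)" for m
    proof -
      define x k where "x = - T n \<omega>" and "k = real (nat \<lfloor>x * real (Suc m)\<rfloor>)"
      have "0 \<le> x * real (Suc m)" using T0 by (intro mult_nonneg_nonneg) (auto simp: x_def)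
      then have "k \<le> x * real (Suc m)" "x * real (Suc m) < k + 1"
        unfolding k_def by linarith+
      then have "k / real (Suc m) \<le> x" "x < (k + 1) / real (Suc m)"
        by (simp_all only: pos_divide_le_eq pos_less_divide_eq of_nat_0_less_iff zero_less_Suc)
      moreover have "\<tau> m \<omega> = - (k / real (Suc m))" by (simp add: \<tau>_def s_def k_def x_def)
      ultimately show "T n \<omega> \<le> \<tau> m \<omega>" "\<tau> m \<omega> < T n \<omega> + 1 / real (Suc m)"
        by (simp_all add: x_def add_divide_distrib)
    qed
    have small: "(\<lambda>m. 1 / real (Suc m)) \<longlonglongrightarrow> 0" by (rule LIMSEQ_Suc[OF lim_const_over_n])
    show lim: "(\<lambda>m. \<tau> m \<omega>) \<longlonglongrightarrow> T n \<omega>"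
    proof (rule tendsto_sandwich[OF _ _ tendsto_const])
      show "(\<lambda>m. T n \<omega> + 1 / real (Suc m)) \<longlonglongrightarrow> T n \<omega>"
        using tendsto_add[OF tendsto_const[of "T n \<omega>"] small] by simp
      show "\<forall>\<^sub>F m in sequentially. T n \<omega> \<le> \<tau> m \<omega>"
        "\<forall>\<^sub>F m in sequentially. \<tau> m \<omega> \<le> T n \<omega> + 1 / real (Suc m)"
        by (intro always_eventually allI \<tau>bnd(1) less_imp_le[OF \<tau>bnd(2)])+
    qed
    \<comment> \<open>The next jump comes strictly later than \<open>T n\<close>, so the
      approximation from the right eventually falls between the two; thus every point of
      \<open>C\<close> ends up in \<open>U m\<close>.\<close>
    have inU: "\<forall>\<^sub>F m in sequentially. \<omega> \<in> U m"
      using order_tendstoD(2)[OF lim T_strict[OF wS n T0]]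
    proof eventually_elim
      case (elim m)
      define i where "i = nat \<lfloor>- T n \<omega> * real (Suc m)\<rfloor>"
      have \<tau>i: "\<tau> m \<omega> = s m i" by (simp add: \<tau>_def i_def)
      have "s m (Suc i) = s m i - 1 / real (Suc m)" by (simp add: s_def add_divide_distrib diff_divide_distrib)
      then have "\<not> T n \<omega> \<le> s m (Suc i)" using \<tau>bnd[of m] \<tau>i by simp
      then have "Y (s m (Suc i)) \<omega> < n" using T_le_iff[OF wS n s0] by (simp add: not_le)
      moreover have "Y (s m i) \<omega> = n"
        using Y_eq_iff[OF wS n s0] \<tau>bnd(1)[of m] elim \<tau>i by simp
      ultimately have "\<omega> \<in> D m i" using wC \<tau>bnd(1)[of m] \<tau>i by (simp add: D_def)
      then show ?case by (auto simp: U_def)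
    qed
    \<comment> \<open>Right-continuity in terms of jump times:
      \<open>min (\<tau> m \<omega> + a) 0\<close> tends to \<open>w\<close> without going below it,
      and so ends up before the first jump after \<open>w\<close>.\<close>
    define w where "w = min (T n \<omega> + a) 0"
    define k where "k = Y w \<omega>"
    have "n \<le> k" using T_le_iff[OF wS n, of w] T0 a by (simp add: w_def k_def)
    with n have k: "1 \<le> k" by simp
    have wk: "T k \<omega> \<le> w" "w < T (Suc k) \<omega>"
      using Y_eq_iff[OF wS k, of w] by (auto simp: w_def k_def)
    have lim': "(\<lambda>m. min (\<tau> m \<omega> + a) 0) \<longlonglongrightarrow> w"
      unfolding w_def by (intro tendsto_intros lim)
    have "\<forall>\<^sub>F m in sequentially. Y (min (\<tau> m \<omega> + a) 0) \<omega> = k"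
      using order_tendstoD(2)[OF lim' wk(2)]
    proof eventually_elim
      case (elim m)
      have "w \<le> min (\<tau> m \<omega> + a) 0" using \<tau>bnd(1)[of m] by (auto simp: w_def)
      then show ?case using Y_eq_iff[OF wS k, of "min (\<tau> m \<omega> + a) 0"] wk elim by simp
    qed
    with inU show "\<forall>\<^sub>F m in sequentially. \<omega> \<in> U m \<and>
      Y (min (\<tau> m \<omega> + a) 0) \<omega> = Y (min (T n \<omega> + a) 0) \<omega>"
      by eventually_elim (simp add: k_def w_def)
  qed
  have lim_q: "(\<lambda>m. indicator (U m) \<omega> * q (\<tau> m \<omega>) \<omega>) \<longlonglongrightarrow> indicator C \<omega> * q (T n \<omega>) \<omega>" for \<omega>
  proof (cases "\<omega> \<in> C")
    case True
    have "(\<lambda>m. if Y (min (T n \<omega> + a) 0) \<omega> = n then exp (- (real n * max 0 (a + \<tau> m \<omega>))) else 0)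
      \<longlonglongrightarrow> q (T n \<omega>) \<omega>"
      unfolding q_def using \<tau>lim[OF True] by (auto intro!: tendsto_intros)
    moreover have "\<forall>\<^sub>F m in sequentially. indicator (U m) \<omega> * q (\<tau> m \<omega>) \<omega> =
        (if Y (min (T n \<omega> + a) 0) \<omega> = n then exp (- (real n * max 0 (a + \<tau> m \<omega>))) else 0)"
      using conv[OF True] by eventually_elim (simp add: q_def)
    ultimately have "(\<lambda>m. indicator (U m) \<omega> * q (\<tau> m \<omega>) \<omega>) \<longlonglongrightarrow> q (T n \<omega>) \<omega>"
      by (simp add: tendsto_cong)
    with True show ?thesis by simp
  next
    case False
    then have "\<omega> \<notin> U m" for m using UC by blast
    with False show ?thesis by simp
  qed
  have lim_1: "(\<lambda>m. indicator (U m) \<omega> :: real) \<longlonglongrightarrow> indicator C \<omega>" for \<omega>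
  proof (cases "\<omega> \<in> C")
    case True
    have "\<forall>\<^sub>F m in sequentially. indicator (U m) \<omega> = (1::real)"
      using conv[OF True] by eventually_elim simp
    then show ?thesis using True by (simp add: tendsto_eventually)
  next
    case False
    then have "\<omega> \<notin> U m" for m using UC by blast
    with False show ?thesis by simp
  qed
  have "(\<lambda>m. LINT \<omega>|M. indicator (U m) \<omega> * q (\<tau> m \<omega>) \<omega>) \<longlonglongrightarrow> (LINT \<omega>|M. indicator C \<omega> * q (T n \<omega>) \<omega>)"
    using qM[OF Tn] qM lim_q q01 CM
    by (intro integral_dominated_convergence[where w="\<lambda>_. 1"]) (auto simp: indicator_def)
  moreover have "(\<lambda>m. LINT \<omega>|M. indicator (U m) \<omega> :: real) \<longlonglongrightarrow> (LINT \<omega>|M. indicator C \<omega>)"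
    using CM lim_1 by (intro integral_dominated_convergence[where w="\<lambda>_. 1"]) auto
  then have "(\<lambda>m. exp (- (real n * a)) * prob (U m)) \<longlonglongrightarrow> exp (- (real n * a)) * prob C"
    using CM by (intro tendsto_mult_left) simp
  then have "(\<lambda>m. LINT \<omega>|M. indicator (U m) \<omega> * q (\<tau> m \<omega>) \<omega>) \<longlonglongrightarrow> exp (- (real n * a)) * prob C"
    using int_U by (simp add: set_lebesgue_integral_def)
  ultimately show ?thesis
    using LIMSEQ_unique by (force simp: set_lebesgue_integral_def q_def)
qed

end

section \<open>Completed holding times\<close>

definition exp_law :: "nat \<Rightarrow> real measure" where
  "exp_law n = density lborel (\<lambda>x. ennreal (exponential_density (real n) x))"

lemma sets_exp_law [simp, measurable_cong]: "sets (exp_law n) = sets borel"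
  by (simp add: exp_law_def)

lemma space_exp_law [simp]: "space (exp_law n) = UNIV"
  by (simp add: exp_law_def)

lemma prob_space_exp_law: "1 \<le> n \<Longrightarrow> prob_space (exp_law n)"
  unfolding exp_law_def by (rule prob_space_exponential_density) simp

lemma emeasure_exp_law_greaterThan:
  assumes n: "1 \<le> n"
  shows "emeasure (exp_law n) {a<..} = ennreal (exp (- (real n * max 0 a)))"
proof -
  interpret E: prob_space "exp_law n" by (rule prob_space_exp_law[OF n])
  have D: "distributed (exp_law n) lborel (\<lambda>x. x) (exponential_density (real n))"
    unfolding distributed_def
  proof (intro conjI)
    show "distr (exp_law n) lborel (\<lambda>x. x) = density lborel (\<lambda>x. ennreal (exponential_density (real n) x))"
      using distr_id2[of lborel "exp_law n"] by (simp add: exp_law_def)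
  qed auto
  have pos: "emeasure (exp_law n) {b<..} = ennreal (exp (- (real n * b)))" if "0 \<le> b" for b
  proof -
    have "E.prob {x \<in> space (exp_law n). b < x} = exp (- b * real n)"
      using E.exponential_distributedD_gt[OF D that] n by simp
    moreover have "{x \<in> space (exp_law n). b < x} = {b<..}" by auto
    ultimately show ?thesis by (simp add: E.emeasure_eq_measure mult.commute)
  qed
  show ?thesis
  proof (cases "0 \<le> a")
    case False
    have "emeasure (exp_law n) {0<..} \<le> emeasure (exp_law n) {a<..}"
      using False by (intro emeasure_mono) auto
    then have "emeasure (exp_law n) {a<..} = 1"
      using pos[of 0] E.emeasure_le_1[of "{a<..}"] by simp
    with False show ?thesis by simp
  qed (simp add: pos max_def)
qed

lemma holding_times_eq: "holding_times real = PiM {1..} exp_law"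
  by (simp add: holding_times_def exp_law_def[abs_def])

lemma prob_space_holding_times: "prob_space (holding_times real)"
  unfolding holding_times_eq by (intro prob_space_PiM prob_space_exp_law) simp

text \<open>Positivity matters in the last state: a holding time that is cut off must be completed
  to one that ends strictly after time 0.\<close>

lemma AE_holding_times_pos: "AE e in holding_times real. \<forall>k\<ge>1. 0 < e k"
proof -
  have "AE e in holding_times real. 1 \<le> k \<longrightarrow> 0 < e k" for k
  proof (cases "1 \<le> k")
    case True
    interpret E: prob_space "exp_law k" by (rule prob_space_exp_law[OF True])
    have "E.prob {0<..} = 1"
      using emeasure_exp_law_greaterThan[OF True, of 0] by (simp add: E.emeasure_eq_measure)
    then have "AE x in exp_law k. x \<in> {0<..}" by (subst E.AE_in_set_eq_1) auto
    then show ?thesis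
      unfolding holding_times_eq using True
      by (intro AE_PiM_component[where P="\<lambda>x. 1 \<le> k \<longrightarrow> 0 < x"] prob_space_exp_law) auto
  qed simp
  then show ?thesis by (simp add: AE_all_countable)
qed

context compensated_birth
begin

text \<open>The \<open>n\<close>-th holding time of \<^term>\<open>Y\<close>. One that is cut off by time \<open>0\<close> is completed with an
  independent exponential variable \<open>x\<close> of the same rate, one that starts after time \<open>0\<close> is just \<open>x\<close>.
  By the lack of memory the completed holding times are independent exponential variables.\<close>

definition completed_holding :: "nat \<Rightarrow> 'a \<Rightarrow> real \<Rightarrow> real" where
  "completed_holding n \<omega> x =
    (if T (Suc n) \<omega> \<le> 0 then T (Suc n) \<omega> - T n \<omega> else x + max 0 (- T n \<omega>))"

lemma completed_holding_measurable:
  assumes n: "1 \<le> n"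
  shows "(\<lambda>(\<omega>, x). completed_holding n \<omega> x) \<in> borel_measurable (M \<Otimes>\<^sub>M exp_law n)"
proof -
  note [measurable] = T_measurable[OF n] T_measurable[of "Suc n", simplified]
  show ?thesis unfolding completed_holding_def by measurable
qed

text \<open>The conditional distribution of the completed holding time given the whole path: only
  the auxiliary variable is integrated out. This kernel keeps the auxiliary variables out of the
  induction over the states.\<close>

definition completed_prob :: "nat \<Rightarrow> real set \<Rightarrow> 'a \<Rightarrow> ennreal" where
  "completed_prob n S \<omega> = emeasure (exp_law n) {x. completed_holding n \<omega> x \<in> S}"

lemma completed_prob_measurable:
  assumes n: "1 \<le> n" and [measurable]: "S \<in> sets borel"
  shows "completed_prob n S \<in> borel_measurable M"
proof -
  interpret E: prob_space "exp_law n" by (rule prob_space_exp_law[OF n])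
  note [measurable] = completed_holding_measurable[OF n]
  define X where "X = {p \<in> space (M \<Otimes>\<^sub>M exp_law n). (case p of (\<omega>, x) \<Rightarrow> completed_holding n \<omega> x) \<in> S}"
  have "X \<in> sets (M \<Otimes>\<^sub>M exp_law n)" unfolding X_def by measurable
  from E.measurable_emeasure_Pair[OF this] show ?thesis
    by (rule measurable_cong[THEN iffD1, rotated])
      (auto simp: completed_prob_def X_def space_pair_measure intro!: arg_cong[where f="emeasure (exp_law n)"])
qed

text \<open>Puts the tail into the shape of the integrand in \<open>stay_prob_from_jump\<close>. If
  the next jump occurs by time 0, the holding time is determined and the tail is 0 or 1; otherwise
  it is the exponential tail at \<open>a + T n \<omega>\<close>. Completed holding times are almost
  surely positive, so a negative level may be raised to 0, whence \<open>max 0 a\<close>.\<close>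

lemma completed_prob_greaterThan:
  assumes w: "\<omega> \<in> space M" and n: "1 \<le> n" and T0: "T n \<omega> \<le> 0"
  shows "completed_prob n {a<..} \<omega> = ennreal (if Y (min (T n \<omega> + max 0 a) 0) \<omega> = n
    then exp (- (real n * max 0 (max 0 a + T n \<omega>))) else 0)"
proof -
  interpret E: prob_space "exp_law n" by (rule prob_space_exp_law[OF n])
  have E1: "emeasure (exp_law n) UNIV = 1" using E.emeasure_space_1 by simp
  define v where "v = min (T n \<omega> + max 0 a) 0"
  have v: "v \<le> 0" "T n \<omega> \<le> v" using T0 by (auto simp: v_def)
  have Yv: "Y v \<omega> = n \<longleftrightarrow> v < T (Suc n) \<omega>" using Y_eq_iff[OF w n v(1)] v by simp
  have TT: "T n \<omega> < T (Suc n) \<omega>" by (rule T_strict[OF w n T0])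
  show ?thesis
  proof (cases "T (Suc n) \<omega> \<le> 0")
    case True
    have "completed_prob n {a<..} \<omega> = (if a < T (Suc n) \<omega> - T n \<omega> then 1 else 0)"
      using True by (simp add: completed_prob_def completed_holding_def E1)
    moreover have "a < T (Suc n) \<omega> - T n \<omega> \<longleftrightarrow> v < T (Suc n) \<omega>"
      using True TT by (auto simp: v_def)
    moreover have "max 0 (max 0 a + T n \<omega>) = 0" if "v < T (Suc n) \<omega>"
      using that True by (auto simp: v_def)
    ultimately show ?thesis using Yv by (simp add: v_def[symmetric])
  next
    case False
    have "completed_prob n {a<..} \<omega> = emeasure (exp_law n) {a + T n \<omega><..}"
      using False T0 by (auto simp: completed_prob_def completed_holding_def max_def
          intro!: arg_cong[where f="emeasure (exp_law n)"])
    moreover have "max 0 (a + T n \<omega>) = max 0 (max 0 a + T n \<omega>)" using T0 by auto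
    ultimately show ?thesis
      using False Yv v by (simp add: v_def[symmetric] emeasure_exp_law_greaterThan[OF n])
  qed
qed

text \<open>Lack of memory at a jump time: \<open>C\<close> is known at the \<open>n\<close>-th
  jump, and the completed holding time is independent of it. As functions of \<open>S\<close> both
  sides are finite measures on the line, so it suffices to compare the half-lines
  \<open>{a<..}\<close>.\<close>

lemma completed_prob_pre_jump:
  assumes n: "1 \<le> n" and CM: "C \<in> sets M" and C0: "\<And>\<omega>. \<omega> \<in> C \<Longrightarrow> T n \<omega> \<le> 0"
    and CF: "\<And>u. u \<le> 0 \<Longrightarrow> C \<inter> {\<omega>. T n \<omega> \<le> u} \<in> sets (F u)" and S: "S \<in> sets borel"
  shows "(\<integral>\<^sup>+\<omega>. indicator C \<omega> * completed_prob n S \<omega> \<partial>M) = emeasure M C * emeasure (exp_law n) S"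
proof -
  interpret E: prob_space "exp_law n" by (rule prob_space_exp_law[OF n])
  note [measurable] = completed_holding_measurable[OF n] CM
  have CS: "\<omega> \<in> space M" if "\<omega> \<in> C" for \<omega> using sets.sets_into_space[OF CM] that by blast
  define \<mu> where "\<mu> = distr (density M (indicator C) \<Otimes>\<^sub>M exp_law n) borel (\<lambda>(\<omega>, x). completed_holding n \<omega> x)"
  define \<nu> where "\<nu> = scale_measure (emeasure M C) (exp_law n)"
  have \<mu>: "emeasure \<mu> A = (\<integral>\<^sup>+\<omega>. indicator C \<omega> * completed_prob n A \<omega> \<partial>M)" if [measurable]: "A \<in> sets borel" for A
  proof -
    have sub: "(\<lambda>(\<omega>, x). completed_holding n \<omega> x) \<in> borel_measurable (density M (indicator C) \<Otimes>\<^sub>M exp_law n)"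
      by measurable
    have "emeasure \<mu> A = (\<integral>\<^sup>+\<omega>. emeasure (exp_law n)
        (Pair \<omega> -` ((\<lambda>(\<omega>, x). completed_holding n \<omega> x) -` A \<inter> space (density M (indicator C) \<Otimes>\<^sub>M exp_law n)))
        \<partial>density M (indicator C))"
      unfolding \<mu>_def
      by (subst emeasure_distr[OF sub that], subst E.emeasure_pair_measure_alt)
        (use measurable_sets[OF sub that] in auto)
    also have "\<dots> = (\<integral>\<^sup>+\<omega>. completed_prob n A \<omega> \<partial>density M (indicator C))"
      by (intro nn_integral_cong) (auto simp: completed_prob_def space_pair_measure
          intro!: arg_cong[where f="emeasure (exp_law n)"])
    also have "\<dots> = (\<integral>\<^sup>+\<omega>. indicator C \<omega> * completed_prob n A \<omega> \<partial>M)"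
      by (intro nn_integral_density completed_prob_measurable n) auto
    finally show ?thesis .
  qed
  have "\<mu> = \<nu>"
  proof (rule measure_eqI_lessThan)
    fix a :: real
    have "emeasure \<mu> {a<..} = (\<integral>\<^sup>+\<omega>. ennreal (indicator C \<omega> * (if Y (min (T n \<omega> + max 0 a) 0) \<omega> = n
        then exp (- (real n * max 0 (max 0 a + T n \<omega>))) else 0)) \<partial>M)"
      by (subst \<mu>) (auto intro!: nn_integral_cong simp: indicator_def completed_prob_greaterThan[OF CS n C0])
    also have "\<dots> = ennreal (LINT \<omega>:C|M. if Y (min (T n \<omega> + max 0 a) 0) \<omega> = n
        then exp (- (real n * max 0 (max 0 a + T n \<omega>))) else 0)"
      unfolding set_lebesgue_integral_def real_scaleR_def
    proof (rule nn_integral_eq_integral)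
      have [measurable]: "T n \<in> borel_measurable M" by (rule T_measurable[OF n])
      have [measurable]: "{\<omega> \<in> space M. Y (min (T n \<omega> + max 0 a) 0) \<omega> = n} \<in> sets M"
        by (rule Y_random_eq_measurable[OF n]) simp_all
      show "integrable M (\<lambda>\<omega>. indicator C \<omega> * (if Y (min (T n \<omega> + max 0 a) 0) \<omega> = n
        then exp (- (real n * max 0 (max 0 a + T n \<omega>))) else 0))"
        by (rule integrable_const_bound[where B=1]) (auto simp: indicator_def)
    qed (auto simp: indicator_def)
    also have "\<dots> = ennreal (exp (- (real n * max 0 a)) * prob C)"
      by (subst stay_prob_from_jump[OF n _ CM C0 CF]) auto
    also have "\<dots> = emeasure \<nu> {a<..}"
      by (simp add: \<nu>_def emeasure_exp_law_greaterThan[OF n] emeasure_eq_measure ennreal_mult mult.commute)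
    finally show eq: "emeasure \<mu> {a<..} = emeasure \<nu> {a<..}" .
    show "emeasure \<mu> {a<..} < \<infinity>"
      unfolding eq by (simp add: \<nu>_def emeasure_exp_law_greaterThan[OF n] emeasure_eq_measure ennreal_mult_less_top)
  qed (simp_all add: \<mu>_def \<nu>_def)
  then show ?thesis using \<mu>[OF S] S by (simp add: \<nu>_def)
qed

text \<open>Induction over the states, with a split on whether the \<open>m\<close>-th jump,
  \<open>m = n + 1\<close>, occurs by time 0. If it does, all earlier holding times are observed in
  full and the product is the indicator of an event known at that jump; if not, the
  \<open>m\<close>-th completed holding time is the auxiliary variable alone. Either way the factor
  \<open>emeasure (exp_law m) (A m)\<close> splits off.\<close>

lemma completed_prob_joint:
  assumes [measurable]: "B \<in> sets borel" and A: "\<And>k. A k \<in> sets borel"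
  shows "(\<integral>\<^sup>+\<omega>. indicator B (T 1 \<omega>) * (\<Prod>k\<in>{1..n}. completed_prob k (A k) \<omega>) \<partial>M)
    = emeasure M {\<omega> \<in> space M. T 1 \<omega> \<in> B} * (\<Prod>k\<in>{1..n}. emeasure (exp_law k) (A k))"
proof (induction n)
  have [measurable]: "T 1 \<in> borel_measurable M" by (rule T_measurable) simp
  case 0
  have "(\<integral>\<^sup>+\<omega>. indicator B (T 1 \<omega>) \<partial>M) = (\<integral>\<^sup>+\<omega>. indicator {\<omega> \<in> space M. T 1 \<omega> \<in> B} \<omega> \<partial>M)"
    by (intro nn_integral_cong) (auto simp: indicator_def)
  also have "\<dots> = emeasure M {\<omega> \<in> space M. T 1 \<omega> \<in> B}"
    by (rule nn_integral_indicator) measurable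
  finally show ?case by simp
next
  case (Suc n)
  note [measurable] = T_measurable A
  have T1 [measurable]: "T 1 \<in> borel_measurable M" by (rule T_measurable) simp
  define m where "m = Suc n"
  have m: "1 \<le> m" by (simp add: m_def)
  have Tm [measurable]: "T m \<in> borel_measurable M" by (rule T_measurable[OF m])
  define W where "W \<omega> = indicator B (T 1 \<omega>) * (\<Prod>k\<in>{1..n}. completed_prob k (A k) \<omega>)" for \<omega>
  define L where "L = {\<omega> \<in> space M. 0 < T m \<omega>}"
  define C where "C = {\<omega> \<in> space M. T 1 \<omega> \<in> B \<and> (\<forall>k\<in>{1..n}. T (Suc k) \<omega> - T k \<omega> \<in> A k) \<and> T m \<omega> \<le> 0}"
  have LM [measurable]: "L \<in> sets M" unfolding L_def by measurable
  have Wm [measurable]: "W \<in> borel_measurable M"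
    unfolding W_def using completed_prob_measurable A
    by (intro borel_measurable_times_ennreal borel_measurable_prod_ennreal) auto
  have Qm [measurable]: "completed_prob m (A m) \<in> borel_measurable M"
    by (rule completed_prob_measurable[OF m A])
  have CM [measurable]: "C \<in> sets M"
  proof -
    have "{\<omega> \<in> space M. T (Suc k) \<omega> - T k \<omega> \<in> A k} \<in> sets M" if "k \<in> {1..n}" for k
      using T_measurable[of k] T_measurable[of "Suc k"] A[of k] that by simp
    then have "{\<omega> \<in> space M. \<forall>k\<in>{1..n}. T (Suc k) \<omega> - T k \<omega> \<in> A k} \<in> sets M"
      by (intro sets.sets_Collect_finite_All) auto
    moreover have "{\<omega> \<in> space M. T 1 \<omega> \<in> B} \<in> sets M" "{\<omega> \<in> space M. T m \<omega> \<le> 0} \<in> sets M" by measurable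
    moreover have "C = {\<omega> \<in> space M. T 1 \<omega> \<in> B} \<inter> {\<omega> \<in> space M. \<forall>k\<in>{1..n}. T (Suc k) \<omega> - T k \<omega> \<in> A k}
        \<inter> {\<omega> \<in> space M. T m \<omega> \<le> 0}" by (auto simp: C_def)
    ultimately show ?thesis by auto
  qed
  have CF: "C \<inter> {\<omega>. T m \<omega> \<le> u} \<in> sets (F u)" if u: "u \<le> 0" for u
  proof -
    have min_meas: "1 \<le> k \<Longrightarrow> (\<lambda>\<omega>. min (T k \<omega>) u) \<in> borel_measurable (F u)" for k
      by (rule T_min_F[OF _ u])
    have "{\<omega> \<in> space (F u). min (T (Suc k) \<omega>) u - min (T k \<omega>) u \<in> A k} \<in> sets (F u)" if "k \<in> {1..n}" for k
    proof -
      have [measurable]: "(\<lambda>\<omega>. min (T k \<omega>) u) \<in> borel_measurable (F u)"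
        "(\<lambda>\<omega>. min (T (Suc k) \<omega>) u) \<in> borel_measurable (F u)"
        using min_meas that by auto
      note [measurable] = A[of k]
      show ?thesis by measurable
    qed
    then have 1: "{\<omega> \<in> space (F u). \<forall>k\<in>{1..n}. min (T (Suc k) \<omega>) u - min (T k \<omega>) u \<in> A k} \<in> sets (F u)"
      by (intro sets.sets_Collect_finite_All) auto
    have [measurable]: "(\<lambda>\<omega>. min (T 1 \<omega>) u) \<in> borel_measurable (F u)"
      "Y u \<in> measurable (F u) (count_space UNIV)"
      using min_meas[of 1] Y_F[of u u] u by auto
    have 2: "{\<omega> \<in> space (F u). min (T 1 \<omega>) u \<in> B} \<in> sets (F u)" "{\<omega> \<in> space (F u). m \<le> Y u \<omega>} \<in> sets (F u)"
      by measurable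
    \<comment> \<open>Once the \<open>m\<close>-th jump has occurred by \<open>u\<close>, every
      earlier jump time equals its truncation at \<open>u\<close>, which is measurable for
      \<open>F u\<close>.\<close>
    have "C \<inter> {\<omega>. T m \<omega> \<le> u} = {\<omega> \<in> space (F u). min (T 1 \<omega>) u \<in> B} \<inter>
        {\<omega> \<in> space (F u). \<forall>k\<in>{1..n}. min (T (Suc k) \<omega>) u - min (T k \<omega>) u \<in> A k} \<inter>
        {\<omega> \<in> space (F u). m \<le> Y u \<omega>}" (is "_ = ?R")
    proof (intro set_eqI)
      fix \<omega>
      show "\<omega> \<in> C \<inter> {\<omega>. T m \<omega> \<le> u} \<longleftrightarrow> \<omega> \<in> ?R"
      proof (cases "\<omega> \<in> space M \<and> T m \<omega> \<le> u")
        case True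
        then have "T k \<omega> \<le> u" if "1 \<le> k" "k \<le> m" for k
          using T_mono[of \<omega> k m] that u by fastforce
        then have "min (T k \<omega>) u = T k \<omega>" if "1 \<le> k" "k \<le> m" for k using that by auto
        then show ?thesis using True u T_le_iff[of \<omega> m u] m by (auto simp: C_def m_def)
      next
        case False
        then show ?thesis using T_le_iff[of \<omega> m u] m u by (auto simp: C_def)
      qed
    qed
    then show ?thesis using 1 2 by auto
  qed
  have split: "W \<omega> = indicator C \<omega> + indicator L \<omega> * W \<omega>"
    "W \<omega> * completed_prob m (A m) \<omega> = indicator C \<omega> * completed_prob m (A m) \<omega>
      + indicator L \<omega> * W \<omega> * emeasure (exp_law m) (A m)" if w: "\<omega> \<in> space M" for \<omega>
  proof -
    have "W \<omega> = indicator C \<omega>" if Tm0: "T m \<omega> \<le> 0"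
    proof -
      have "completed_prob k (A k) \<omega> = indicator (A k) (T (Suc k) \<omega> - T k \<omega>)" if "k \<in> {1..n}" for k
      proof -
        have "T (Suc k) \<omega> \<le> 0" using T_mono[OF w, of "Suc k" m] that Tm0 by (simp add: m_def)
        moreover have "emeasure (exp_law k) UNIV = 1"
          using prob_space.emeasure_space_1[OF prob_space_exp_law[of k]] that by simp
        ultimately show ?thesis
          by (simp add: completed_prob_def completed_holding_def indicator_def)
      qed
      then have "W \<omega> = indicator B (T 1 \<omega>) * (\<Prod>k\<in>{1..n}. indicator (A k) (T (Suc k) \<omega> - T k \<omega>))"
        by (simp add: W_def)
      also have "\<dots> = indicator C \<omega>"
        using w Tm0 by (cases "\<forall>k\<in>{1..n}. T (Suc k) \<omega> - T k \<omega> \<in> A k")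
          (auto simp: C_def indicator_def intro!: prod_zero)
      finally show ?thesis .
    qed
    moreover have "completed_prob m (A m) \<omega> = emeasure (exp_law m) (A m)" if "0 < T m \<omega>"
    proof -
      have "\<not> T (Suc m) \<omega> \<le> 0" using T_mono[OF w m, of "Suc m"] that by auto
      with that show ?thesis by (simp add: completed_prob_def completed_holding_def max_def)
    qed
    ultimately show "W \<omega> = indicator C \<omega> + indicator L \<omega> * W \<omega>"
      "W \<omega> * completed_prob m (A m) \<omega> = indicator C \<omega> * completed_prob m (A m) \<omega>
        + indicator L \<omega> * W \<omega> * emeasure (exp_law m) (A m)"
      using w by (cases "0 < T m \<omega>"; simp add: L_def C_def indicator_def)+
  qed
  have "(\<integral>\<^sup>+\<omega>. W \<omega> * completed_prob m (A m) \<omega> \<partial>M) = (\<integral>\<^sup>+\<omega>. indicator C \<omega> * completed_prob m (A m) \<omega>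
      + indicator L \<omega> * W \<omega> * emeasure (exp_law m) (A m) \<partial>M)"
    by (intro nn_integral_cong split)
  also have "\<dots> = (\<integral>\<^sup>+\<omega>. indicator C \<omega> * completed_prob m (A m) \<omega> \<partial>M)
      + (\<integral>\<^sup>+\<omega>. indicator L \<omega> * W \<omega> * emeasure (exp_law m) (A m) \<partial>M)"
    by (rule nn_integral_add) measurable
  also have "(\<integral>\<^sup>+\<omega>. indicator C \<omega> * completed_prob m (A m) \<omega> \<partial>M) = emeasure M C * emeasure (exp_law m) (A m)"
    by (rule completed_prob_pre_jump[OF m CM _ CF A]) (simp_all add: C_def)
  also have "(\<integral>\<^sup>+\<omega>. indicator L \<omega> * W \<omega> * emeasure (exp_law m) (A m) \<partial>M)
      = (\<integral>\<^sup>+\<omega>. indicator L \<omega> * W \<omega> \<partial>M) * emeasure (exp_law m) (A m)"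
    by (rule nn_integral_multc) measurable
  also have "emeasure M C * emeasure (exp_law m) (A m) + (\<integral>\<^sup>+\<omega>. indicator L \<omega> * W \<omega> \<partial>M) * emeasure (exp_law m) (A m)
      = ((\<integral>\<^sup>+\<omega>. indicator C \<omega> \<partial>M) + (\<integral>\<^sup>+\<omega>. indicator L \<omega> * W \<omega> \<partial>M)) * emeasure (exp_law m) (A m)"
    by (simp add: distrib_right)
  also have "(\<integral>\<^sup>+\<omega>. indicator C \<omega> \<partial>M) + (\<integral>\<^sup>+\<omega>. indicator L \<omega> * W \<omega> \<partial>M)
      = (\<integral>\<^sup>+\<omega>. indicator C \<omega> + indicator L \<omega> * W \<omega> \<partial>M)"
    by (rule nn_integral_add[symmetric]) measurable
  also have "\<dots> = (\<integral>\<^sup>+\<omega>. W \<omega> \<partial>M)"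
    by (intro nn_integral_cong split(1)[symmetric])
  finally have "(\<integral>\<^sup>+\<omega>. W \<omega> * completed_prob m (A m) \<omega> \<partial>M) = (\<integral>\<^sup>+\<omega>. W \<omega> \<partial>M) * emeasure (exp_law m) (A m)" .
  then show ?case using Suc by (simp add: W_def m_def mult_ac)
qed

end

section \<open>Measurability of the birth path and tools for product measures\<close>

text \<open>Joint measurability in the start time and the holding times makes the probabilities of
  the chain up to the horizon a measurable function of the start time. Paths have uncountably many
  coordinates, but one time at a time is enough in the product sigma-algebra.\<close>

lemma restricted_birth_path_measurable:
  assumes sets_H: "sets H = sets (\<Pi>\<^sub>M k\<in>{1::nat..}. (borel :: real measure))"
  shows "(\<lambda>(t, h). restrict_path (- t) (birth_path h)) \<in> measurable (borel \<Otimes>\<^sub>M H) path_space"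
proof -
  have comp: "(\<lambda>p. snd p k) \<in> borel_measurable (borel \<Otimes>\<^sub>M H)" if "k \<in> {1..n}" for k n :: nat
  proof -
    have "(\<lambda>h. h k) \<in> borel_measurable H"
      using measurable_component_singleton[of k "{1::nat..}" "\<lambda>_. borel :: real measure"] that
      by (simp add: measurable_cong_sets[OF sets_H refl])
    then show ?thesis by (rule measurable_compose[OF measurable_snd])
  qed
  have [measurable]: "(\<lambda>p. \<Sum>k=1..n. snd p k) \<in> borel_measurable (borel \<Otimes>\<^sub>M H)" for n :: nat
    by (rule borel_measurable_sum) (rule comp)
  have [measurable]: "(\<lambda>p. birth_path (snd p) s) \<in> measurable (borel \<Otimes>\<^sub>M H) (count_space UNIV)" for s
    unfolding birth_path_def by measurable
  have "(\<lambda>p. \<lambda>s\<in>{0..}. if s \<le> - fst p then birth_path (snd p) s else 0)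
      \<in> measurable (borel \<Otimes>\<^sub>M H) path_space"
    unfolding path_space_def by (rule measurable_restrict) measurable
  then show ?thesis by (simp add: restrict_path_def case_prod_beta')
qed

lemma mem_prod_emb_iff:
  "J \<subseteq> I \<Longrightarrow> h \<in> prod_emb I N J (Pi\<^sub>E J A) \<longleftrightarrow> h \<in> space (PiM I N) \<and> (\<forall>k\<in>J. h k \<in> A k)"
  by (auto simp: prod_emb_def space_PiM PiE_iff)

lemma (in pair_prob_space) AE_snd:
  assumes "AE y in M2. Q y"
  shows "AE p in M1 \<Otimes>\<^sub>M M2. Q (snd p)"
proof -
  obtain N where N: "N \<in> null_sets M2" "{y \<in> space M2. \<not> Q y} \<subseteq> N"
    using assms by (auto elim!: AE_E simp: null_sets_def)
  show ?thesis
  proof (rule AE_I[where N="space M1 \<times> N"])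
    show "emeasure (M1 \<Otimes>\<^sub>M M2) (space M1 \<times> N) = 0"
      using N by (subst M2.emeasure_pair_measure_Times) auto
  qed (use N in \<open>auto simp: space_pair_measure\<close>)
qed

lemma (in finite_measure) sigma_finite_subalgebraI:
  "subalgebra M G \<Longrightarrow> sigma_finite_subalgebra M G"
  by (intro finite_measure_subalgebra_is_sigma_finite finite_measure_subalgebra.intro
      finite_measure_subalgebra_axioms.intro finite_measure_axioms)

lemma sets_holding_times: "sets (holding_times rate) = sets (\<Pi>\<^sub>M k\<in>{1::nat..}. (borel :: real measure))"
  unfolding holding_times_def by (intro sets_PiM_cong) auto

section \<open>The law of the completed holding times\<close>

context compensated_birth
begin

text \<open>The auxiliary variables form a sequence drawn from \<open>holding_times real\<close>
  independently of the path, which supplies a fresh exponential variable of the right rate for each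
  state.\<close>

abbreviation completed_holdings :: "'a \<times> (nat \<Rightarrow> real) \<Rightarrow> nat \<Rightarrow> real" where
  "completed_holdings p \<equiv> (\<lambda>k\<in>{1..}. completed_holding k (fst p) (snd p k))"

lemma completed_holdings_measurable:
  "completed_holdings \<in> measurable (M \<Otimes>\<^sub>M holding_times real) (holding_times real)"
  unfolding holding_times_eq
proof (rule measurable_restrict)
  fix k :: nat assume k: "k \<in> {1..}"
  have "(\<lambda>p. (fst p, snd p k)) \<in> measurable (M \<Otimes>\<^sub>M PiM {1..} exp_law) (M \<Otimes>\<^sub>M exp_law k)"
    using k by measurable
  from measurable_compose[OF this completed_holding_measurable] k
  show "(\<lambda>p. completed_holding k (fst p) (snd p k)) \<in> measurable (M \<Otimes>\<^sub>M PiM {1..} exp_law) (exp_law k)"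
    by (simp add: measurable_cong_sets[OF refl sets_exp_law])
qed

text \<open>Fubini with the path fixed: the section of the event is empty or a cylinder in the
  auxiliary sequence, whose coordinates are independent, so its measure is a product of values of
  \<open>completed_prob\<close>.\<close>

lemma completed_holdings_cylinder:
  assumes B [measurable]: "B \<in> sets borel" and J: "finite J" "J \<subseteq> {1..}"
    and A: "\<And>k. k \<in> J \<Longrightarrow> A k \<in> sets borel"
  shows "emeasure (M \<Otimes>\<^sub>M holding_times real) {p \<in> space (M \<Otimes>\<^sub>M holding_times real).
      T 1 (fst p) \<in> B \<and> completed_holdings p \<in> prod_emb {1..} exp_law J (Pi\<^sub>E J A)}
    = emeasure M {\<omega> \<in> space M. T 1 \<omega> \<in> B} * emeasure (holding_times real) (prod_emb {1..} exp_law J (Pi\<^sub>E J A))"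
proof -
  interpret H: prob_space "holding_times real" by (rule prob_space_holding_times)
  have T1 [measurable]: "T 1 \<in> borel_measurable M" by (rule T_measurable) simp
  define X where "X = {p \<in> space (M \<Otimes>\<^sub>M holding_times real).
      T 1 (fst p) \<in> B \<and> completed_holdings p \<in> prod_emb {1..} exp_law J (Pi\<^sub>E J A)}"
  have emb: "prod_emb {1..} exp_law J (Pi\<^sub>E J A) \<in> sets (holding_times real)"
    unfolding holding_times_eq using J A by (intro sets_PiM_I) auto
  have "{p \<in> space (M \<Otimes>\<^sub>M holding_times real). T 1 (fst p) \<in> B} \<in> sets (M \<Otimes>\<^sub>M holding_times real)" by measurable
  moreover have "X = {p \<in> space (M \<Otimes>\<^sub>M holding_times real). T 1 (fst p) \<in> B} \<inter>
    (completed_holdings -` prod_emb {1..} exp_law J (Pi\<^sub>E J A) \<inter> space (M \<Otimes>\<^sub>M holding_times real))"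
    by (auto simp: X_def)
  ultimately have XM: "X \<in> sets (M \<Otimes>\<^sub>M holding_times real)"
    using measurable_sets[OF completed_holdings_measurable emb] by auto
  \<comment> \<open>Padding with \<open>UNIV\<close> turns \<open>J\<close> into an initial segment,
    as \<open>completed_prob_joint\<close> requires; the added factors are 1.\<close>
  define A' where "A' k = (if k \<in> J then A k else UNIV)" for k
  obtain n where n: "J \<subseteq> {1..n}"
  proof
    show "J \<subseteq> {1..Max (insert 0 J)}" using J by (auto simp: Max_ge)
  qed
  have one: "emeasure (exp_law k) UNIV = 1" if "1 \<le> k" for k
    using prob_space.emeasure_space_1[OF prob_space_exp_law[OF that]] by simp
  have J1: "1 \<le> k" if "k \<in> J" for k using J that by auto
  have "emeasure (M \<Otimes>\<^sub>M holding_times real) X = (\<integral>\<^sup>+\<omega>. emeasure (holding_times real) (Pair \<omega> -` X) \<partial>M)"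
    by (rule H.emeasure_pair_measure_alt[OF XM])
  also have "\<dots> = (\<integral>\<^sup>+\<omega>. indicator B (T 1 \<omega>) * (\<Prod>k\<in>{1..n}. completed_prob k (A' k) \<omega>) \<partial>M)"
  proof (rule nn_integral_cong)
    fix \<omega> assume w: "\<omega> \<in> space M"
    define S where "S k = {x. completed_holding k \<omega> x \<in> A k}" for k
    have S: "S k \<in> sets (exp_law k)" if "k \<in> J" for k
    proof -
      have [measurable]: "A k \<in> sets borel" by (rule A[OF that])
      show ?thesis unfolding S_def completed_holding_def by simp
    qed
    have "Pair \<omega> -` X = (if T 1 \<omega> \<in> B then prod_emb {1..} exp_law J (Pi\<^sub>E J S) else {})"
      using w J by (auto simp: X_def S_def mem_prod_emb_iff[OF J(2), simplified] space_pair_measure holding_times_eq space_PiM PiE_iff subset_iff)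
    moreover have "emeasure (holding_times real) (prod_emb {1..} exp_law J (Pi\<^sub>E J S)) = (\<Prod>k\<in>J. emeasure (exp_law k) (S k))"
      unfolding holding_times_eq using J S by (intro emeasure_PiM_emb prob_space_exp_law) auto
    moreover have "(\<Prod>k\<in>J. emeasure (exp_law k) (S k)) = (\<Prod>k\<in>{1..n}. completed_prob k (A' k) \<omega>)"
      using n one by (intro prod.mono_neutral_cong_left) (auto simp: A'_def completed_prob_def S_def)
    ultimately show "emeasure (holding_times real) (Pair \<omega> -` X)
        = indicator B (T 1 \<omega>) * (\<Prod>k\<in>{1..n}. completed_prob k (A' k) \<omega>)"
      by (simp add: indicator_def)
  qed
  also have "\<dots> = emeasure M {\<omega> \<in> space M. T 1 \<omega> \<in> B} * (\<Prod>k\<in>{1..n}. emeasure (exp_law k) (A' k))"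
    using A by (intro completed_prob_joint) (auto simp: A'_def)
  also have "(\<Prod>k\<in>{1..n}. emeasure (exp_law k) (A' k)) = (\<Prod>k\<in>J. emeasure (exp_law k) (A k))"
    using n one by (intro prod.mono_neutral_cong_right) (auto simp: A'_def)
  also have "\<dots> = emeasure (holding_times real) (prod_emb {1..} exp_law J (Pi\<^sub>E J A))"
    unfolding holding_times_eq using J J1 A by (intro emeasure_PiM_emb[symmetric] prob_space_exp_law) auto
  finally show ?thesis by (simp add: X_def)
qed

text \<open>Rectangles \<open>B \<times> D\<close> determine the product measure, and for fixed
  \<open>B\<close> both sides are finite measures in \<open>D\<close>, which agree as soon as they
  agree on cylinders.\<close>

lemma distr_completed_holdings:
  "distr (M \<Otimes>\<^sub>M holding_times real) (borel \<Otimes>\<^sub>M holding_times real) (\<lambda>p. (T 1 (fst p), completed_holdings p))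
    = distr M borel (T 1) \<Otimes>\<^sub>M holding_times real" (is "distr ?P ?Q ?\<Phi> = _")
proof (rule pair_measure_eqI[symmetric])
  interpret H: prob_space "holding_times real" by (rule prob_space_holding_times)
  interpret P: pair_prob_space M "holding_times real" ..
  have T1 [measurable]: "T 1 \<in> borel_measurable M" by (rule T_measurable) simp
  note [measurable] = completed_holdings_measurable
  interpret D: prob_space "distr M borel (T 1)" by (rule prob_space_distr[OF T1])
  show "sigma_finite_measure (distr M borel (T 1))" "sigma_finite_measure (holding_times real)" ..
  show "sets (distr M borel (T 1) \<Otimes>\<^sub>M holding_times real) = sets (distr ?P ?Q ?\<Phi>)"
    by (simp cong: sets_pair_measure_cong)
  fix B :: "real set" and D assume B: "B \<in> sets (distr M borel (T 1))" and D: "D \<in> sets (holding_times real)"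
  then have [measurable]: "B \<in> sets borel" by simp
  define R where "R = {p \<in> space ?P. T 1 (fst p) \<in> B}"
  have R [measurable]: "R \<in> sets ?P" unfolding R_def by measurable
  define \<mu> where "\<mu> = distr (density ?P (indicator R)) (holding_times real) completed_holdings"
  define \<nu> where "\<nu> = scale_measure (emeasure M {\<omega> \<in> space M. T 1 \<omega> \<in> B}) (holding_times real)"
  have \<mu>: "emeasure \<mu> E = emeasure ?P {p \<in> space ?P. T 1 (fst p) \<in> B \<and> completed_holdings p \<in> E}"
    if E: "E \<in> sets (holding_times real)" for E
  proof -
    have m: "completed_holdings \<in> measurable (density ?P (indicator R)) (holding_times real)"
      by measurable
    have vs: "completed_holdings -` E \<inter> space ?P \<in> sets ?P"
      by (rule measurable_sets[OF completed_holdings_measurable E])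
    have "emeasure \<mu> E = emeasure (density ?P (indicator R)) (completed_holdings -` E \<inter> space ?P)"
      unfolding \<mu>_def by (subst emeasure_distr[OF m E]) simp
    also have "\<dots> = (\<integral>\<^sup>+p. indicator R p * indicator (completed_holdings -` E \<inter> space ?P) p \<partial>?P)"
      by (rule emeasure_density) (use vs in auto)
    also have "\<dots> = (\<integral>\<^sup>+p. indicator (R \<inter> (completed_holdings -` E \<inter> space ?P)) p \<partial>?P)"
      by (simp add: indicator_inter_arith)
    also have "\<dots> = emeasure ?P (R \<inter> (completed_holdings -` E \<inter> space ?P))"
      using vs by (intro nn_integral_indicator) auto
    also have "R \<inter> (completed_holdings -` E \<inter> space ?P) = {p \<in> space ?P. T 1 (fst p) \<in> B \<and> completed_holdings p \<in> E}"
      by (auto simp: R_def)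
    finally show ?thesis .
  qed
  have "\<mu> = \<nu>"
  proof (rule measure_eqI_PiM_infinite[where I="{1..}" and M=exp_law])
    show "sets \<mu> = sets (PiM {1..} exp_law)" "sets \<nu> = sets (PiM {1..} exp_law)"
      by (simp_all add: \<mu>_def \<nu>_def holding_times_eq)
    show "finite_measure \<mu>"
    proof
      have "emeasure \<mu> (space \<mu>) \<le> emeasure ?P (space ?P)"
        by (subst \<mu>) (auto simp: \<mu>_def intro!: emeasure_mono)
      also have "\<dots> = 1" by (rule P.emeasure_space_1)
      finally show "emeasure \<mu> (space \<mu>) \<noteq> \<infinity>" by (auto simp: top_unique)
    qed
    fix A and J :: "nat set" assume J: "finite J" "J \<subseteq> {1..}" and A: "\<And>k. k \<in> J \<Longrightarrow> A k \<in> sets (exp_law k)"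
    have "prod_emb {1..} exp_law J (Pi\<^sub>E J A) \<in> sets (holding_times real)"
      unfolding holding_times_eq using J A by (intro sets_PiM_I) auto
    then show "emeasure \<mu> (prod_emb {1..} exp_law J (Pi\<^sub>E J A)) = emeasure \<nu> (prod_emb {1..} exp_law J (Pi\<^sub>E J A))"
      using J A by (simp add: \<mu> \<nu>_def completed_holdings_cylinder[simplified])
  qed
  then have "emeasure \<mu> D = emeasure \<nu> D" by simp
  also have "emeasure \<mu> D = emeasure (distr ?P ?Q ?\<Phi>) (B \<times> D)"
  proof -
    have \<Phi>: "?\<Phi> \<in> measurable ?P ?Q" by measurable
    have BD: "B \<times> D \<in> sets ?Q" using D by auto
    have "?\<Phi> -` (B \<times> D) \<inter> space ?P = {p \<in> space ?P. T 1 (fst p) \<in> B \<and> completed_holdings p \<in> D}" by auto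
    then show ?thesis unfolding \<mu>[OF D] emeasure_distr[OF \<Phi> BD] by simp
  qed
  also have "emeasure \<nu> D = emeasure (distr M borel (T 1)) B * emeasure (holding_times real) D"
  proof -
    have "T 1 -` B \<inter> space M = {\<omega> \<in> space M. T 1 \<omega> \<in> B}" by auto
    then show ?thesis using emeasure_distr[OF T1, of B] by (simp add: \<nu>_def)
  qed
  finally show "emeasure (distr M borel (T 1)) B * emeasure (holding_times real) D = emeasure (distr ?P ?Q ?\<Phi>) (B \<times> D)"
    by simp
qed

section \<open>The path as a birth path with the completed holding times\<close>

text \<open>The observed holding times telescope. In the last state the auxiliary variable is added
  to \<open>- T n \<omega>\<close>, so that on the original time axis the completed holding time
  ends at \<open>e n\<close>.\<close>

lemma sum_completed_holding:
  assumes w: "\<omega> \<in> space M" and n: "n \<le> Y 0 \<omega>" "1 \<le> n"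
  shows "(\<Sum>k=1..n. completed_holding k \<omega> (e k))
    = (if n < Y 0 \<omega> then T (Suc n) \<omega> else e n) - T 1 \<omega>"
proof -
  have "n < Y 0 \<omega> \<Longrightarrow> (\<Sum>k=1..n. completed_holding k \<omega> (e k)) = T (Suc n) \<omega> - T 1 \<omega>" for n
  proof (induction n)
    case (Suc n)
    then have "T (Suc (Suc n)) \<omega> \<le> 0" using T_le_iff[OF w, of "Suc (Suc n)" 0] by simp
    with Suc show ?case by (simp add: completed_holding_def)
  qed simp
  note lt = this
  show ?thesis
  proof (cases "n < Y 0 \<omega>")
    case True
    then show ?thesis using lt by simp
  next
    case False
    with n obtain m where m: "n = Suc m" "m < Y 0 \<omega>" "n = Y 0 \<omega>" by (cases n) auto
    have "\<not> T (Suc n) \<omega> \<le> 0" using T_le_iff[OF w, of "Suc n" 0] m by simp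
    moreover have "T n \<omega> \<le> 0" using T_le_iff[OF w n(2), of 0] m by simp
    ultimately show ?thesis using lt[OF m(2)] m by (simp add: completed_holding_def)
  qed
qed

text \<open>Up to time 0 the path does not go beyond the state \<open>Y 0 \<omega>\<close>. The
  partial sums below that state are the true times of departure, counted from
  \<open>T 1 \<omega>\<close>; only the last one involves \<open>e\<close>.\<close>

lemma restrict_path_completed_holdings:
  assumes w: "\<omega> \<in> space M" and e: "\<And>k. 1 \<le> k \<Longrightarrow> 0 < e k"
  shows "restrict_path (- T 1 \<omega>) (birth_path (completed_holdings (\<omega>, e)))
    = restrict_path (- T 1 \<omega>) (\<lambda>s. Y (T 1 \<omega> + s) \<omega>)"
proof -
  have "birth_path (completed_holdings (\<omega>, e)) s = Y (T 1 \<omega> + s) \<omega>" if s: "0 \<le> s" "s \<le> - T 1 \<omega>" for s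
  proof -
    define y where "y = Y (T 1 \<omega> + s) \<omega>"
    have u0: "T 1 \<omega> + s \<le> 0" using s by simp
    have y: "1 \<le> y" "y \<le> Y 0 \<omega>"
      using T_le_iff[OF w _ u0, of 1] s Y_mono[OF w u0] by (auto simp: y_def)
    define \<Sigma> where "\<Sigma> n = (\<Sum>k=1..n. completed_holdings (\<omega>, e) k)" for n
    have \<Sigma>: "\<Sigma> n = (if n < Y 0 \<omega> then T (Suc n) \<omega> else e n) - T 1 \<omega>" if "n \<le> Y 0 \<omega>" "1 \<le> n" for n
      using sum_completed_holding[OF w that, of e] by (simp add: \<Sigma>_def)
    \<comment> \<open>On the original time axis state \<open>y\<close> ends at the next jump, which
      is after the present time, or, if \<open>y\<close> is the last state, at \<open>e y\<close>,
      which is positive.\<close>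
    have hit: "s < \<Sigma> y"
      using \<Sigma>[OF y(2,1)] Y_eq_iff[OF w y(1) u0] s e[OF y(1)] by (auto simp: y_def)
    have least: "y \<le> n" if "s < \<Sigma> n" for n
    proof (rule ccontr)
      assume "\<not> y \<le> n"
      then have ny: "n < y" by simp
      \<comment> \<open>The empty sum is 0, and \<open>0 <= s\<close>.\<close>
      have "n \<noteq> 0" using that s by (auto simp: \<Sigma>_def intro: ccontr)
      then have "\<Sigma> n = T (Suc n) \<omega> - T 1 \<omega>" using \<Sigma>[of n] ny y by simp
      moreover have "T (Suc n) \<omega> \<le> T 1 \<omega> + s" using T_le_iff[OF w _ u0, of "Suc n"] ny by (simp add: y_def)
      ultimately show False using that by simp
    qed
    have "(LEAST n. s < \<Sigma> n) = y" by (rule Least_equality) (use hit least in auto)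
    then show ?thesis using hit unfolding birth_path_def \<Sigma>_def[symmetric] y_def[symmetric] by auto
  qed
  then show ?thesis by (auto simp: restrict_path_def fun_eq_iff)
qed

end

section \<open>The conditional law of the path\<close>

context compensated_birth
begin

text \<open>Almost surely the path is \<open>\<Psi>\<close> applied to \<open>T 1\<close> and the
  completed holding times. The two are independent, so conditioning on \<open>T 1\<close> freezes
  the first argument and leaves the law of the chain up to the horizon \<open>- T 1\<close>.\<close>

lemma pure_birth_after_first_jump:
  "has_conditional_law M (T 1) path_space
    (\<lambda>\<omega>. restrict_path (- T 1 \<omega>) (\<lambda>s. Y (T 1 \<omega> + s) \<omega>)) (\<lambda>t. pure_birth_law real (- t))"
  unfolding has_conditional_law_def
proof (intro conjI ballI)
  interpret H: prob_space "holding_times real" by (rule prob_space_holding_times)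
  interpret P: pair_prob_space M "holding_times real" ..
  define X where "X \<omega> = restrict_path (- T 1 \<omega>) (\<lambda>s. Y (T 1 \<omega> + s) \<omega>)" for \<omega>
  define \<Psi> where "\<Psi> = (\<lambda>(t, h). restrict_path (- t) (birth_path h))"
  have \<Psi> [measurable]: "\<Psi> \<in> measurable (borel \<Otimes>\<^sub>M holding_times real) path_space"
    unfolding \<Psi>_def by (rule restricted_birth_path_measurable[OF sets_holding_times])
  show T1 [measurable]: "T 1 \<in> borel_measurable M" by (rule T_measurable) simp
  have X_meas [measurable]: "X \<in> measurable M path_space"
    unfolding X_def restrict_path_def path_space_def
  proof (rule measurable_restrict)
    fix s :: real assume s: "s \<in> {0..}"
    \<comment> \<open>\<open>Y\<close> is controlled at times up to 0 only, so the evaluation time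
      is cut off there; for larger \<open>s\<close> the restricted path has the value 0.\<close>
    define W where "W \<omega> = min (T 1 \<omega> + s) 0" for \<omega>
    have W1: "W \<in> borel_measurable M" unfolding W_def
      by (intro borel_measurable_min borel_measurable_add borel_measurable_const T1)
    have W2: "W \<omega> \<le> 0" for \<omega> by (simp add: W_def)
    have YW: "(\<lambda>\<omega>. Y (W \<omega>) \<omega>) \<in> measurable M (count_space UNIV)"
    proof (rule measurable_count_space_eq2_countable[THEN iffD2])
      show "(\<lambda>\<omega>. Y (W \<omega>) \<omega>) \<in> space M \<rightarrow> UNIV \<and> (\<forall>n\<in>UNIV. (\<lambda>\<omega>. Y (W \<omega>) \<omega>) -` {n} \<inter> space M \<in> sets M)"
      proof (intro conjI ballI)
        fix n
        have pos: "1 \<le> Y (W \<omega>) \<omega>" if "\<omega> \<in> space M" for \<omega>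
        proof -
          have "T 1 \<omega> \<le> W \<omega>" unfolding W_def using T_1_le[OF that] s by simp
          then show ?thesis using T_le_iff[OF that order_refl W2] by simp
        qed
        have "{\<omega> \<in> space M. Y (W \<omega>) \<omega> = n} \<in> sets M"
        proof (cases "n = 0")
          case True
          then have "{\<omega> \<in> space M. Y (W \<omega>) \<omega> = n} = {}" by (auto dest: pos)
          then show ?thesis by (simp only: sets.empty_sets)
        qed (use Y_random_eq_measurable[OF _ W1 W2, of n] in simp)
        moreover have "(\<lambda>\<omega>. Y (W \<omega>) \<omega>) -` {n} \<inter> space M = {\<omega> \<in> space M. Y (W \<omega>) \<omega> = n}" by auto
        ultimately show "(\<lambda>\<omega>. Y (W \<omega>) \<omega>) -` {n} \<inter> space M \<in> sets M" by simp
      qed simp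
    qed
    have "(\<lambda>\<omega>. if s \<le> - T 1 \<omega> then Y (W \<omega>) \<omega> else 0) \<in> measurable M (count_space UNIV)"
      by (intro measurable_If YW measurable_const) measurable
    moreover have "(if s \<le> - T 1 \<omega> then Y (W \<omega>) \<omega> else 0) = (if s \<le> - T 1 \<omega> then Y (T 1 \<omega> + s) \<omega> else 0)" for \<omega>
      by (simp add: W_def)
    ultimately show "(\<lambda>\<omega>. if s \<le> - T 1 \<omega> then Y (T 1 \<omega> + s) \<omega> else 0) \<in> measurable M (count_space UNIV)" by simp
  qed
  show "(\<lambda>\<omega>. restrict_path (- T 1 \<omega>) (\<lambda>s. Y (T 1 \<omega> + s) \<omega>)) \<in> measurable M path_space"
    using X_meas unfolding X_def .
  fix A assume A [measurable]: "A \<in> sets path_space"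
  define g where "g t = measure (pure_birth_law real (- t)) A" for t
  have g_eq: "ennreal (g t) = emeasure (holding_times real) {h \<in> space (holding_times real). \<Psi> (t, h) \<in> A}" for t
  proof -
    have m: "(\<lambda>h. \<Psi> (t, h)) \<in> measurable (holding_times real) path_space"
      by (rule measurable_compose[OF measurable_Pair1' \<Psi>]) simp
    then show ?thesis
      unfolding g_def pure_birth_law_def H.emeasure_eq_measure
      by (subst measure_distr) (auto simp: \<Psi>_def vimage_def Int_def conj_commute)
  qed
  have g_meas [measurable]: "g \<in> borel_measurable borel"
  proof -
    have "{p \<in> space (borel \<Otimes>\<^sub>M holding_times real). \<Psi> p \<in> A} \<in> sets (borel \<Otimes>\<^sub>M holding_times real)"
      by (rule measurable_sets_Collect[OF \<Psi>]) (use A in auto)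
    from H.measurable_emeasure_Pair[OF this]
    have "(\<lambda>t. ennreal (g t)) \<in> borel_measurable borel"
      by (rule measurable_cong[THEN iffD1, rotated])
        (auto simp: g_eq space_pair_measure intro!: arg_cong[where f="emeasure (holding_times real)"])
    then have "(\<lambda>t. enn2real (ennreal (g t))) \<in> borel_measurable borel" by measurable
    then show ?thesis by (simp add: g_def[abs_def])
  qed
  have g01: "0 \<le> g t" "g t \<le> 1" for t
  proof -
    show "0 \<le> g t" by (simp add: g_def)
    have "ennreal (g t) \<le> 1" unfolding g_eq by (rule H.emeasure_le_1)
    then show "g t \<le> 1" by simp
  qed
  have XA [measurable]: "X -` A \<inter> space M \<in> sets M" by (rule measurable_sets[OF X_meas A])
  have joint: "emeasure M {\<omega> \<in> space M. T 1 \<omega> \<in> B \<and> X \<omega> \<in> A} = (\<integral>\<^sup>+\<omega>. indicator B (T 1 \<omega>) * ennreal (g (T 1 \<omega>)) \<partial>M)"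
    if B [measurable]: "B \<in> sets borel" for B
  proof -
    let ?P = "M \<Otimes>\<^sub>M holding_times real"
    let ?\<Phi> = "\<lambda>p. (T 1 (fst p), completed_holdings p)"
    note [measurable] = completed_holdings_measurable
    have "{\<omega> \<in> space M. T 1 \<omega> \<in> B \<and> X \<omega> \<in> A} = (T 1 -` B \<inter> space M) \<inter> (X -` A \<inter> space M)" by auto
    then have TX: "{\<omega> \<in> space M. T 1 \<omega> \<in> B \<and> X \<omega> \<in> A} \<in> sets M"
      using measurable_sets[OF T1 B] XA by simp
    define E where "E = {p \<in> space (borel \<Otimes>\<^sub>M holding_times real). fst p \<in> B \<and> \<Psi> p \<in> A}"
    have E [measurable]: "E \<in> sets (borel \<Otimes>\<^sub>M holding_times real)" unfolding E_def by measurable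
    have \<Phi>: "?\<Phi> \<in> measurable ?P (borel \<Otimes>\<^sub>M holding_times real)" by measurable
    \<comment> \<open>The event does not involve the auxiliary sequence; a factor of mass 1 moves it
      to the product space, where the completed holding times live.\<close>
    have "emeasure M {\<omega> \<in> space M. T 1 \<omega> \<in> B \<and> X \<omega> \<in> A}
        = emeasure ?P ({\<omega> \<in> space M. T 1 \<omega> \<in> B \<and> X \<omega> \<in> A} \<times> space (holding_times real))"
      by (subst H.emeasure_pair_measure_Times[OF TX sets.top]) (simp add: H.emeasure_space_1)
    also have "\<dots> = emeasure ?P (?\<Phi> -` E \<inter> space ?P)"
    proof (rule emeasure_eq_AE)
      \<comment> \<open>The exceptional null set concerns the auxiliary sequence alone, so the
        identity holds for all \<open>\<omega>\<close> at once.\<close>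
      have "AE e in holding_times real. \<forall>\<omega>\<in>space M. \<Psi> (T 1 \<omega>, completed_holdings (\<omega>, e)) = X \<omega>"
        using AE_holding_times_pos
        by eventually_elim (use restrict_path_completed_holdings in \<open>auto simp: \<Psi>_def X_def\<close>)
      from P.AE_snd[OF this]
      show "AE p in ?P. p \<in> {\<omega> \<in> space M. T 1 \<omega> \<in> B \<and> X \<omega> \<in> A} \<times> space (holding_times real)
          \<longleftrightarrow> p \<in> ?\<Phi> -` E \<inter> space ?P"
        using AE_space
      proof eventually_elim
        case (elim p)
        then have "\<Psi> (?\<Phi> p) = X (fst p)" "?\<Phi> p \<in> space (borel \<Otimes>\<^sub>M holding_times real)"
          using measurable_space[OF \<Phi>] by (auto simp: space_pair_measure)
        with elim show ?case by (auto simp: E_def space_pair_measure)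
      qed
    qed (use measurable_sets[OF \<Phi> E] TX in auto)
    also have "\<dots> = emeasure (distr M borel (T 1) \<Otimes>\<^sub>M holding_times real) E"
      using emeasure_distr[OF \<Phi> E] distr_completed_holdings by simp
    also have "\<dots> = (\<integral>\<^sup>+t. emeasure (holding_times real) (Pair t -` E) \<partial>distr M borel (T 1))"
      using E by (intro H.emeasure_pair_measure_alt) (simp cong: sets_pair_measure_cong)
    also have "\<dots> = (\<integral>\<^sup>+t. indicator B t * ennreal (g t) \<partial>distr M borel (T 1))"
      by (intro nn_integral_cong)
        (auto simp: g_eq E_def space_pair_measure indicator_def intro!: arg_cong[where f="emeasure (holding_times real)"])
    also have "\<dots> = (\<integral>\<^sup>+\<omega>. indicator B (T 1 \<omega>) * ennreal (g (T 1 \<omega>)) \<partial>M)"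
      by (rule nn_integral_distr) measurable
    finally show ?thesis .
  qed
  have gT: "(\<lambda>\<omega>. g (T 1 \<omega>)) \<in> borel_measurable M" by (rule measurable_compose[OF T1 g_meas])
  let ?F = "vimage_algebra (space M) (T 1) borel"
  have "subalgebra M ?F"
    unfolding subalgebra_def using measurable_sets[OF T1]
    by (auto simp: sets_vimage_algebra2)
  then interpret S: sigma_finite_subalgebra M ?F by (rule sigma_finite_subalgebraI)
  have "AE \<omega> in M. real_cond_exp M ?F (indicator (X -` A \<inter> space M)) \<omega> = g (T 1 \<omega>)"
  proof (rule S.real_cond_exp_charact)
    show "integrable M (indicator (X -` A \<inter> space M) :: 'a \<Rightarrow> real)"
      by (intro integrable_real_indicator) (auto simp: emeasure_eq_measure)
    show "integrable M (\<lambda>\<omega>. g (T 1 \<omega>))"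
      using g01 by (intro integrable_const_bound[where B=1, OF _ gT]) auto
    show "(\<lambda>\<omega>. g (T 1 \<omega>)) \<in> borel_measurable ?F"
      by (rule measurable_compose[OF measurable_vimage_algebra1 g_meas]) simp
    fix C assume "C \<in> sets ?F"
    then obtain B where B [measurable]: "B \<in> sets borel" and C: "C = T 1 -` B \<inter> space M"
      by (auto simp: sets_vimage_algebra2)
    have "(LINT \<omega>:C|M. indicator (X -` A \<inter> space M) \<omega>) = (LINT \<omega>|M. indicator {\<omega> \<in> space M. T 1 \<omega> \<in> B \<and> X \<omega> \<in> A} \<omega>)"
      unfolding set_lebesgue_integral_def
      by (intro Bochner_Integration.integral_cong refl) (auto simp: C indicator_def)
    also have "\<dots> = prob {\<omega> \<in> space M. T 1 \<omega> \<in> B \<and> X \<omega> \<in> A}"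
    proof -
      have "{\<omega> \<in> space M. T 1 \<omega> \<in> B \<and> X \<omega> \<in> A} \<inter> space M = {\<omega> \<in> space M. T 1 \<omega> \<in> B \<and> X \<omega> \<in> A}" by auto
      then show ?thesis by (simp only: Bochner_Integration.integral_indicator)
    qed
    also have "\<dots> = enn2real (\<integral>\<^sup>+\<omega>. indicator B (T 1 \<omega>) * ennreal (g (T 1 \<omega>)) \<partial>M)"
      by (simp only: joint[OF B, symmetric] measure_def)
    also have "(\<integral>\<^sup>+\<omega>. indicator B (T 1 \<omega>) * ennreal (g (T 1 \<omega>)) \<partial>M) = (\<integral>\<^sup>+\<omega>. ennreal (indicator C \<omega> * g (T 1 \<omega>)) \<partial>M)"
      by (intro nn_integral_cong) (auto simp: C indicator_def)
    also have "enn2real \<dots> = (LINT \<omega>:C|M. g (T 1 \<omega>))"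
    proof -
      have "C \<in> sets M" using measurable_sets[OF T1 B] by (simp add: C)
      then have "(\<lambda>\<omega>. indicator C \<omega> * g (T 1 \<omega>)) \<in> borel_measurable M"
        by (intro borel_measurable_times borel_measurable_indicator gT)
      then show ?thesis
        unfolding set_lebesgue_integral_def using g01 by (subst integral_eq_nn_integral) auto
    qed
    finally show "(LINT \<omega>:C|M. indicator (X -` A \<inter> space M) \<omega>) = (LINT \<omega>:C|M. g (T 1 \<omega>))" .
  qed
  then show "AE \<omega> in M. real_cond_exp M ?F
      (indicator ((\<lambda>\<omega>. restrict_path (- T 1 \<omega>) (\<lambda>s. Y (T 1 \<omega> + s) \<omega>)) -` A \<inter> space M)) \<omega>
    = measure (pure_birth_law real (- T 1 \<omega>)) A"
    by (simp add: X_def[abs_def] g_def)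
qed

end

section \<open>The passage to logarithmic time\<close>

text \<open>Time 0 is not of the form \<open>exp s\<close>; but \<open>N 0\<close> is constant, so
  its preimages are trivial and nothing is lost.\<close>

lemma natural_filtration_exp:
  assumes N0: "\<And>\<omega>. \<omega> \<in> space M \<Longrightarrow> N 0 \<omega> = 0" and u: "u \<le> 0"
  shows "natural_filtration M {..0} (\<lambda>u. N (exp u)) u = natural_filtration M {0..1} N (exp u)"
proof -
  let ?G = "{N (exp s) -` A \<inter> space M | s A. s \<in> {..0} \<and> s \<le> u}"
  let ?H = "{N s -` A \<inter> space M | s A. s \<in> {0..1} \<and> s \<le> exp u}"
  have "sigma_sets (space M) ?G = sigma_sets (space M) ?H"
  proof (rule sigma_sets_eqI)
    fix X assume "X \<in> ?G"
    then obtain s A where "X = N (exp s) -` A \<inter> space M" "s \<le> u" by blast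
    with u have "X \<in> ?H" by (intro CollectI exI[of _ "exp s"] exI[of _ A]) auto
    then show "X \<in> sigma_sets (space M) ?H" ..
  next
    fix X assume "X \<in> ?H"
    then obtain s A where X: "X = N s -` A \<inter> space M" and s: "0 \<le> s" "s \<le> exp u" by auto
    show "X \<in> sigma_sets (space M) ?G"
    proof (cases "s = 0")
      case True
      then have "X = (if 0 \<in> A then space M else {})" using X N0 by auto
      then show ?thesis by (simp add: sigma_sets_top sigma_sets.Empty)
    next
      case False
      with s have "0 < s" by simp
      then have "ln s \<le> u" using s by (metis exp_le_cancel_iff exp_ln)
      moreover have "s \<le> 1" using s u order_trans[of s "exp u" 1] by simp
      ultimately have "X \<in> ?G" using X u \<open>0 < s\<close> by (intro CollectI exI[of _ "ln s"] exI[of _ A]) auto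
      then show ?thesis ..
    qed
  qed
  then show ?thesis unfolding natural_filtration_def by (intro sigma_eqI) auto
qed

lemma (in finite_measure) martingale_on_set_integral:
  assumes X: "martingale_on M I G X" and st: "s \<in> I" "t \<in> I" "s \<le> t" and A: "A \<in> sets (G s)"
  shows "(LINT \<omega>:A|M. X t \<omega>) = (LINT \<omega>:A|M. X s \<omega>)"
proof -
  have sub: "subalgebra M (G s)" and int: "integrable M (X t)" "integrable M (X s)"
    and ae: "AE \<omega> in M. real_cond_exp M (G s) (X t) \<omega> = X s \<omega>"
    using X st by (auto simp: martingale_on_def)
  interpret S: sigma_finite_subalgebra M "G s" by (rule sigma_finite_subalgebraI[OF sub])
  have AM: "A \<in> sets M" using A sub by (auto simp: subalgebra_def)
  have "(LINT \<omega>:A|M. X t \<omega>) = (LINT \<omega>:A|M. real_cond_exp M (G s) (X t) \<omega>)"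
    by (rule S.real_cond_exp_intA[OF int(1) A])
  also have "\<dots> = (LINT \<omega>:A|M. X s \<omega>)"
    unfolding set_lebesgue_integral_def
    using ae AM S.real_cond_exp_int(1)[OF int(1)] int(2)
    by (intro integral_cong_AE) (auto intro: borel_measurable_integrable)
  finally show ?thesis .
qed

lemma mono_on_weighted_set_integrable:
  fixes f :: "real \<Rightarrow> nat"
  assumes f: "mono_on {a..b} f" and w [measurable]: "w \<in> borel_measurable borel"
    and bnd: "\<And>s. s \<in> {a..b} \<Longrightarrow> \<bar>w s\<bar> \<le> K"
  shows "set_integrable lborel {a..b} (\<lambda>s. real (f s) * w s)"
proof (cases "a \<le> b")
  case True
  \<comment> \<open>Clamping the argument to \<open>[a, b]\<close> extends \<open>f\<close> to a
    monotone function on the line, which gives Borel measurability.\<close>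
  define g where "g s = real (f (max a (min b s)))" for s
  have "mono g"
    unfolding g_def using True by (intro monoI of_nat_mono mono_onD[OF f]) auto
  then have [measurable]: "g \<in> borel_measurable borel" by (rule borel_measurable_mono)
  have gf: "g s = real (f s)" if "s \<in> {a..b}" for s using that by (simp add: g_def)
  have "integrable lborel (\<lambda>s. indicator {a..b} s *\<^sub>R (g s * w s))"
  proof (rule integrableI_bounded_set_indicator[where B="real (f b) * K"])
    show "AE s in lborel. s \<in> {a..b} \<longrightarrow> norm (g s * w s) \<le> real (f b) * K"
    proof (intro AE_I2 impI)
      fix s assume s: "s \<in> {a..b}"
      then have "f s \<le> f b" using mono_onD[OF f, of s b] by auto
      then show "norm (g s * w s) \<le> real (f b) * K"
        using bnd[OF s] gf[OF s] by (auto simp: abs_mult intro!: mult_mono)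
    qed
  qed (auto simp: emeasure_lborel_Icc_eq)
  also have "(\<lambda>s. indicator {a..b} s *\<^sub>R (g s * w s)) = (\<lambda>s. indicator {a..b} s *\<^sub>R (real (f s) * w s))"
    by (auto simp: indicator_def gf fun_eq_iff)
  finally show ?thesis by (simp add: set_integrable_def)
qed (simp add: set_integrable_def)

section \<open>Hitting times of a counting path and the change of time\<close>

text \<open>An integer-valued right-continuous path is constant just after \<open>\<tau>\<close>, so
  the infimum is attained. Just before \<open>\<tau>\<close> it is constant and below
  \<open>n\<close>, and a jump of size at most 1 cannot carry it past \<open>n\<close>.\<close>

lemma counting_path_Inf:
  fixes f :: "real \<Rightarrow> nat"
  assumes f0: "f 0 = 0" and mono: "mono_on {0..1} f"
    and right: "\<And>t. t \<in> {0..<1} \<Longrightarrow> continuous (at_right t) f"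
    and left: "\<And>t. t \<in> {0<..1} \<Longrightarrow> \<exists>l. (f \<longlongrightarrow> l) (at_left t) \<and> f t \<in> {l, l + 1}"
    and n: "1 \<le> n" "n \<le> f 1"
  defines "\<tau> \<equiv> Inf {t \<in> {0..1}. n \<le> f t}"
  shows "0 < \<tau>" "\<tau> \<le> 1" "\<And>t. t \<in> {0..1} \<Longrightarrow> \<tau> \<le> t \<longleftrightarrow> n \<le> f t" "f \<tau> = n"
proof -
  define S where "S = {t \<in> {0..1}. n \<le> f t}"
  have S: "1 \<in> S" "bdd_below S" using n by (auto simp: S_def)
  have \<tau>_le: "\<tau> \<le> t" if "t \<in> S" for t
    unfolding \<tau>_def S_def[symmetric] using that S by (intro cInf_lower) auto
  have \<tau>1: "\<tau> \<le> 1" using \<tau>_le S by simp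
  have \<tau>0: "0 \<le> \<tau>"
    unfolding \<tau>_def S_def[symmetric] using S by (intro cInf_greatest) (auto simp: S_def)
  have ge: "n \<le> f \<tau>"
  proof (cases "\<tau> = 1")
    case False
    then have "(f \<longlongrightarrow> f \<tau>) (at_right \<tau>)"
      using right[of \<tau>] \<tau>0 \<tau>1 by (simp add: continuous_within)
    then have "\<forall>\<^sub>F s in at_right \<tau>. f s = f \<tau>"
      by (simp add: tendsto_discrete)
    then obtain b where b: "b > \<tau>" "\<And>y. \<tau> < y \<Longrightarrow> y < b \<Longrightarrow> f y = f \<tau>"
      unfolding eventually_at_right_field by auto
    obtain s where s: "s \<in> S" "s < b"
      using cInf_lessD[of S b] S b(1) unfolding \<tau>_def S_def[symmetric] by auto
    have "f s = f \<tau>" using \<tau>_le[OF s(1)] b(2)[of s] s(2) by (cases "s = \<tau>") auto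
    then show ?thesis using s(1) by (simp add: S_def)
  qed (use n in simp)
  show pos: "0 < \<tau>" using \<tau>0 ge n f0 by (cases "\<tau> = 0") auto
  show "\<tau> \<le> 1" by (rule \<tau>1)
  show iff: "\<tau> \<le> t \<longleftrightarrow> n \<le> f t" if t: "t \<in> {0..1}" for t
  proof
    assume "\<tau> \<le> t"
    then have "f \<tau> \<le> f t" using mono_onD[OF mono, of \<tau> t] t \<tau>0 \<tau>1 by auto
    with ge show "n \<le> f t" by simp
  next
    assume "n \<le> f t" then show "\<tau> \<le> t" using \<tau>_le[of t] t by (simp add: S_def)
  qed
  obtain l where l: "(f \<longlongrightarrow> l) (at_left \<tau>)" "f \<tau> \<in> {l, l + 1}" using left[of \<tau>] pos \<tau>1 by auto
  from l(1) have "\<forall>\<^sub>F s in at_left \<tau>. f s = l"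
    by (simp add: tendsto_discrete)
  then obtain b where b: "b < \<tau>" "\<And>y. b < y \<Longrightarrow> y < \<tau> \<Longrightarrow> f y = l"
    unfolding eventually_at_left_field by auto
  \<comment> \<open>A point close enough to \<open>\<tau>\<close> for the path to have its left
    limit as value; the bound \<open>\<tau> / 2\<close> keeps it in \<open>[0, 1]\<close>.\<close>
  define y where "y = max ((b + \<tau>) / 2) (\<tau> / 2)"
  have y: "b < y" "y < \<tau>" "0 \<le> y" using b(1) pos by (auto simp: y_def less_max_iff_disj)
  have "\<not> n \<le> f y" using iff[of y] y \<tau>1 by simp
  then show "f \<tau> = n" using b(2)[OF y(1,2)] l(2) ge by auto
qed

lemma exp_max_ln:
  fixes x u :: real
  shows "0 < x \<Longrightarrow> exp (max u (ln x)) = max (exp u) x"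
  by (cases "u \<le> ln x") (auto simp: max_def ln_ge_iff)

text \<open>Under \<open>s = exp x\<close> the weight \<open>1 / s\<close> cancels against the
  derivative.\<close>

lemma set_integral_divide_eq_log_time:
  fixes f :: "real \<Rightarrow> nat"
  assumes f: "mono_on {0..1} f" and ab: "0 < a" "a \<le> b" "b \<le> 1"
  shows "(LBINT s:{a..b}. real (f s) / s) = (LBINT s:{ln a..ln b}. real (f (exp s)))"
proof -
  have e: "exp (ln a) = a" "exp (ln b) = b" using ab by auto
  have "set_integrable lborel {a..b} (\<lambda>s. real (f s) * (1 / s))"
    using ab by (intro mono_on_weighted_set_integrable[where K="1 / a"] mono_on_subset[OF f])
      (auto intro: frac_le)
  then have int: "set_integrable lborel {exp (ln a)..exp (ln b)} (\<lambda>s. real (f s) / s)"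
    by (simp add: e)
  have "(LBINT s. real (f s) / s * indicator {exp (ln a)..exp (ln b)} s)
      = (LBINT s. real (f (exp s)) / exp s * exp s * indicator {ln a..ln b} s)"
    using ab by (intro integral_substitution(2)[where g=exp and g'=exp, OF int]) (auto intro!: derivative_eq_intros continuous_intros)
  then show ?thesis by (simp add: e set_lebesgue_integral_def mult.commute)
qed

lemma counting_process_Inf:
  assumes c: "counting_process M N" and w: "\<omega> \<in> space M" and n: "1 \<le> n" "n \<le> N 1 \<omega>"
  defines "\<tau> \<equiv> Inf {t \<in> {0..1}. n \<le> N t \<omega>}"
  shows "0 < \<tau>" "\<tau> \<le> 1" "\<And>t. t \<in> {0..1} \<Longrightarrow> \<tau> \<le> t \<longleftrightarrow> n \<le> N t \<omega>" "N \<tau> \<omega> = n"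
proof -
  have path: "N 0 \<omega> = 0" "mono_on {0..1} (\<lambda>t. N t \<omega>)"
    "\<And>t. t \<in> {0..<1} \<Longrightarrow> continuous (at_right t) (\<lambda>s. N s \<omega>)"
    "\<And>t. t \<in> {0<..1} \<Longrightarrow> \<exists>l. ((\<lambda>s. N s \<omega>) \<longlongrightarrow> l) (at_left t) \<and> N t \<omega> \<in> {l, l + 1}"
    using c w unfolding counting_process_def by blast+
  note hit = counting_path_Inf[where f="\<lambda>t. N t \<omega>" and n=n]
  show "0 < \<tau>" unfolding \<tau>_def by (rule hit(1)) (fact path n)+
  show "\<tau> \<le> 1" unfolding \<tau>_def by (rule hit(2)) (fact path n)+
  show "N \<tau> \<omega> = n" unfolding \<tau>_def by (rule hit(4)) (fact path n)+
  show "\<tau> \<le> t \<longleftrightarrow> n \<le> N t \<omega>" if "t \<in> {0..1}" for t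
    unfolding \<tau>_def by (rule hit(3)) (fact path n that)+
qed

text \<open>The times in state 1 are only part of the times in state 1 or higher, but unit jumps
  place the earliest of the latter in state 1.\<close>

lemma first_jump_eq:
  assumes c: "counting_process M N" and w: "\<omega> \<in> space M" "1 \<le> N 1 \<omega>"
  shows "first_jump N \<omega> = Inf {t \<in> {0..1}. 1 \<le> N t \<omega>}" (is "_ = ?\<tau>")
proof -
  note hit = counting_process_Inf[OF c w(1) order_refl w(2)]
  show ?thesis
    unfolding first_jump_def
  proof (rule cInf_eq_minimum)
    show "?\<tau> \<in> {t \<in> {0..1}. N t \<omega> = 1}" using hit(1,2,4) by simp
    fix t assume "t \<in> {t \<in> {0..1}. N t \<omega> = 1}"
    then show "?\<tau> \<le> t" using hit(3)[of t] by simp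
  qed
qed

lemma pi_compensated_exp:
  assumes c: "counting_process M N" and w: "\<omega> \<in> space M" "1 \<le> N 1 \<omega>" and u: "u \<le> 0"
  shows "pi_compensated N (exp u) \<omega> =
    real (N (exp (max u (ln (first_jump N \<omega>)))) \<omega>) - real (N (exp (ln (first_jump N \<omega>))) \<omega>)
    - (LBINT s:{ln (first_jump N \<omega>)..max u (ln (first_jump N \<omega>))}. real (N (exp s) \<omega>))"
proof -
  define \<tau> where "\<tau> = first_jump N \<omega>"
  have \<tau>: "0 < \<tau>" "\<tau> \<le> 1"
    unfolding \<tau>_def first_jump_eq[OF c w] by (rule counting_process_Inf[OF c w(1) order_refl w(2)])+
  have mono: "mono_on {0..1} (\<lambda>t. N t \<omega>)" using c w by (simp add: counting_process_def)
  have b: "\<tau> \<le> max (exp u) \<tau>" "max (exp u) \<tau> \<le> 1" using \<tau> u by auto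
  have lnb: "ln (max (exp u) \<tau>) = max u (ln \<tau>)"
    using exp_max_ln[OF \<tau>(1), of u] by (metis ln_exp)
  show ?thesis
    using set_integral_divide_eq_log_time[OF mono \<tau>(1) b] exp_max_ln[OF \<tau>(1), of u] \<tau>(1)
    by (simp add: pi_compensated_def Let_def \<tau>_def[symmetric] lnb)
qed

section \<open>Reduction of the p.i.-counting process to the compensated birth process\<close>

text \<open>The case \<open>n = 1\<close> is singled out so that \<open>T 1\<close> is literally the
  logarithm of \<open>first_jump N\<close>, the variable on which the final statement conditions; by
  \<open>first_jump_eq\<close> it agrees with the general formula.\<close>

lemma compensated_birth_log_time:
  assumes M: "prob_space M" and pi: "pi_counting_process M N"
  shows "compensated_birth M (\<lambda>u. N (exp u))
    (\<lambda>n \<omega>. if n = 1 then ln (first_jump N \<omega>)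
      else if n \<le> N 1 \<omega> then ln (Inf {t \<in> {0..1}. n \<le> N t \<omega>}) else 1)
    (\<lambda>u. pi_compensated N (exp u))" (is "compensated_birth M ?Y ?T ?Z")
proof -
  interpret prob_space M by (rule M)
  have c: "counting_process M N" and N1: "\<And>\<omega>. \<omega> \<in> space M \<Longrightarrow> 1 \<le> N 1 \<omega>"
    and mart: "martingale_on M {0<..1} (natural_filtration M {0..1} N) (pi_compensated N)"
    using pi by (auto simp: pi_counting_process_def)
  have N0: "\<And>\<omega>. \<omega> \<in> space M \<Longrightarrow> N 0 \<omega> = 0"
    and mono: "\<And>\<omega>. \<omega> \<in> space M \<Longrightarrow> mono_on {0..1} (\<lambda>t. N t \<omega>)"
    using c by (auto simp: counting_process_def)
  have T: "?T n \<omega> = (if n \<le> N 1 \<omega> then ln (Inf {t \<in> {0..1}. n \<le> N t \<omega>}) else 1)"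
    if "\<omega> \<in> space M" for n \<omega>
    using N1[OF that] first_jump_eq[OF c that N1[OF that]] by simp
  note hit = counting_process_Inf[OF c]
  show ?thesis
  proof
    show "?Y u \<in> measurable M (count_space UNIV)" if "u \<le> 0" for u
      using c that by (simp add: counting_process_def)
    show "integrable M (?Z u)" if "u \<le> 0" for u
      using mart that by (simp add: martingale_on_def)
    show "(LINT \<omega>:A|M. ?Z v \<omega>) = (LINT \<omega>:A|M. ?Z u \<omega>)"
      if "u \<le> v" "v \<le> 0" "A \<in> sets (natural_filtration M {..0} ?Y u)" for u v A
      using that natural_filtration_exp[of M N u, OF N0]
      by (intro martingale_on_set_integral[OF mart]) auto
    fix \<omega> assume w: "\<omega> \<in> space M"
    show "?T n \<omega> \<le> u \<longleftrightarrow> n \<le> ?Y u \<omega>" if "1 \<le> n" "u \<le> 0" for n u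
    proof (cases "n \<le> N 1 \<omega>")
      case True
      have "ln (Inf {t \<in> {0..1}. n \<le> N t \<omega>}) \<le> u \<longleftrightarrow> Inf {t \<in> {0..1}. n \<le> N t \<omega>} \<le> exp u"
        using hit(1)[OF w that(1) True] by (metis exp_le_cancel_iff exp_ln)
      then show ?thesis unfolding T[OF w] using hit(3)[OF w that(1) True, of "exp u"] True that by simp
    next
      case False
      moreover have "N (exp u) \<omega> \<le> N 1 \<omega>" using mono_onD[OF mono[OF w], of "exp u" 1] that by simp
      ultimately show ?thesis unfolding T[OF w] using that by simp
    qed
    show "?Y (?T n \<omega>) \<omega> = n" if "1 \<le> n" "?T n \<omega> \<le> 0" for n
    proof -
      have "n \<le> N 1 \<omega>" using that(2) unfolding T[OF w] by (auto split: if_splits)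
      then show ?thesis unfolding T[OF w] using hit(1,4)[OF w that(1)] by simp
    qed
    show "?T n \<omega> \<le> 0 \<or> ?T n \<omega> = 1" if "1 \<le> n" for n
      unfolding T[OF w] using hit(1,2)[OF w that] by simp
    show "?T 1 \<omega> \<le> 0" using hit(1,2)[OF w order_refl N1[OF w]] N1[OF w] unfolding T[OF w] by simp
    fix u v :: real assume uv: "u \<le> v" "v \<le> 0" and Yu: "1 \<le> ?Y u \<omega>"
    define t where "t = ln (first_jump N \<omega>)"
    define y where "y s = N (exp s) \<omega>" for s
    have y: "mono_on {..0} y"
      unfolding y_def by (intro mono_onI mono_onD[OF mono[OF w]]) auto
    have y_int: "set_integrable lborel A (\<lambda>s. real (y s))" if "A \<subseteq> {a..b}" "A \<in> sets borel" "b \<le> 0" for A a b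
    proof -
      have "set_integrable lborel {a..b} (\<lambda>s. real (y s) * 1)"
        using that by (intro mono_on_weighted_set_integrable[where K=1] mono_on_subset[OF y]) auto
      then show ?thesis using set_integrable_subset[of lborel "{a..b}" _ A] that by simp
    qed
    have hit1: "0 < first_jump N \<omega>" "first_jump N \<omega> \<le> exp u"
      using hit(1)[OF w order_refl N1[OF w]] hit(3)[OF w order_refl N1[OF w], of "exp u"] Yu uv
      by (auto simp: first_jump_eq[OF c w N1[OF w]])
    then have tu: "t \<le> u" unfolding t_def by (metis exp_le_cancel_iff exp_ln)
    \<comment> \<open>The first jump is not after \<open>u\<close>, so from \<open>u\<close> on the
      maxima in the compensated process drop out, and the drift over \<open>[u, v]\<close> becomes
      an integral of the monotone \<open>y\<close>, bounded by its end values.\<close>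
    have Z: "?Z r \<omega> = real (y r) - real (y t) - (LBINT s:{t..r}. real (y s))" if "u \<le> r" "r \<le> 0" for r
      using pi_compensated_exp[OF c w N1[OF w], of r] tu that by (simp add: t_def[symmetric] y_def max_absorb1)
    have "{t..v} = {t..u} \<union> {u<..v}" using tu uv by auto
    then have "(LBINT s:{t..v}. real (y s)) = (LBINT s:{t..u}. real (y s)) + (LBINT s:{u<..v}. real (y s))"
      using uv tu by (simp only:) (intro set_integral_Un y_int[of _ t v], auto)
    then have drift: "real (y v) - real (y u) - (?Z v \<omega> - ?Z u \<omega>) = (LBINT s:{u<..v}. real (y s))"
      using Z[of u] Z[of v] uv by simp
    have const: "set_integrable lborel {u<..v} (\<lambda>s. k)" "(LBINT s:{u<..v}. k) = (v - u) * k" for k :: real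
      using uv by (auto simp: set_integrable_def set_lebesgue_integral_def)
    have yi: "set_integrable lborel {u<..v} (\<lambda>s. real (y s))" using uv by (intro y_int[of _ u v]) auto
    have "(LBINT s:{u<..v}. real (y u)) \<le> (LBINT s:{u<..v}. real (y s))"
      using uv by (intro set_integral_mono const yi) (auto intro: mono_onD[OF y])
    moreover have "(LBINT s:{u<..v}. real (y s)) \<le> (LBINT s:{u<..v}. real (y v))"
      using uv by (intro set_integral_mono const yi) (auto intro: mono_onD[OF y])
    ultimately show "real (?Y v \<omega>) - real (?Y u \<omega>) - (?Z v \<omega> - ?Z u \<omega>)
        \<in> {(v - u) * real (?Y u \<omega>) .. (v - u) * real (?Y v \<omega>)}"
      using drift by (simp add: const(2) y_def)
  qed
qed

theorem proposition3p1:
  fixes M :: "'a measure"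
    and N N' :: "real \<Rightarrow> 'a \<Rightarrow> nat"
    and T1 t1 :: "'a \<Rightarrow> real"
  assumes "prob_space M"
    and "pi_counting_process M N"
    and "T1 = first_jump N"
    and "N' = (\<lambda>u. N (exp u))"
    and "t1 = (\<lambda>\<omega>. ln (T1 \<omega>))"
  shows "(\<forall>\<omega>\<in>space M. \<forall>u\<in>{..0}.
            pi_compensated N (exp u) \<omega>
              = real (N (max (exp u) (T1 \<omega>)) \<omega>) - real (N (T1 \<omega>) \<omega>)
                - (LBINT s:{T1 \<omega>..max (exp u) (T1 \<omega>)}. real (N s \<omega>) / s) \<and>
            pi_compensated N (exp u) \<omega>
              = real (N' (max u (t1 \<omega>)) \<omega>) - real (N' (t1 \<omega>) \<omega>)
                - (LBINT s:{t1 \<omega>..max u (t1 \<omega>)}. real (N' s \<omega>)))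
       \<and> martingale_on M {..0} (natural_filtration M {..0} N') (\<lambda>u. pi_compensated N (exp u))
       \<and> has_conditional_law M t1 path_space
            (\<lambda>\<omega>. restrict_path (- t1 \<omega>) (\<lambda>s. N' (t1 \<omega> + s) \<omega>))
            (\<lambda>t. pure_birth_law real (- t))"
proof (intro conjI ballI)
  have c: "counting_process M N" and N1: "\<And>\<omega>. \<omega> \<in> space M \<Longrightarrow> 1 \<le> N 1 \<omega>"
    and mart: "martingale_on M {0<..1} (natural_filtration M {0..1} N) (pi_compensated N)"
    using assms(2) by (auto simp: pi_counting_process_def)
  have N0: "\<And>\<omega>. \<omega> \<in> space M \<Longrightarrow> N 0 \<omega> = 0"
    using c by (auto simp: counting_process_def)
  show "pi_compensated N (exp u) \<omega> = real (N (max (exp u) (T1 \<omega>)) \<omega>) - real (N (T1 \<omega>) \<omega>)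
      - (LBINT s:{T1 \<omega>..max (exp u) (T1 \<omega>)}. real (N s \<omega>) / s)" for \<omega> u
    by (simp add: pi_compensated_def Let_def assms(3))
  show "pi_compensated N (exp u) \<omega> = real (N' (max u (t1 \<omega>)) \<omega>) - real (N' (t1 \<omega>) \<omega>)
      - (LBINT s:{t1 \<omega>..max u (t1 \<omega>)}. real (N' s \<omega>))" if "\<omega> \<in> space M" "u \<in> {..0}" for \<omega> u
    using pi_compensated_exp[OF c that(1) N1[OF that(1)], of u] that(2) by (simp add: assms(3-5))
  have filt: "natural_filtration M {..0} N' u = natural_filtration M {0..1} N (exp u)" if "u \<le> 0" for u
    unfolding assms(4) by (rule natural_filtration_exp[of M N u, OF N0 that])
  \<comment> \<open>The time change is deterministic and increasing, it maps the nonpositive times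
    into \<open>(0, 1]\<close>, and the filtrations correspond by \<open>filt\<close>; so each
    clause of the martingale property is inherited.\<close>
  show "martingale_on M {..0} (natural_filtration M {..0} N') (\<lambda>u. pi_compensated N (exp u))"
    using mart by (simp add: martingale_on_def filt filtration_natural_filtration)
  interpret compensated_birth M "\<lambda>u. N (exp u)"
    "\<lambda>n \<omega>. if n = 1 then ln (first_jump N \<omega>)
      else if n \<le> N 1 \<omega> then ln (Inf {t \<in> {0..1}. n \<le> N t \<omega>}) else 1"
    "\<lambda>u. pi_compensated N (exp u)"
    by (rule compensated_birth_log_time[OF assms(1,2)])
  show "has_conditional_law M t1 path_space
      (\<lambda>\<omega>. restrict_path (- t1 \<omega>) (\<lambda>s. N' (t1 \<omega> + s) \<omega>)) (\<lambda>t. pure_birth_law real (- t))"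
    using pure_birth_after_first_jump by (simp add: assms(3-5))
qed

end
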